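(* Let $G$ be a finite group and let $\alpha$ be a unitary multiplier on $G$. Let $C^{(1)},\dots,C^{(m)}$ be the $\alpha$-regular conjugacy classes of $G$, and fix one representative $c^{(i)}_0\in C^{(i)}$ for each $1\le i\le m$. For each $\alpha$-regular class $A$ define the $m\times m$ complex matrix $M_A$, with rows and columns indexed by the $\alpha$-regular classes $B,C$ (in the order $C^{(1)},\dots,C^{(m)}$), by $$(M_A)_{BC} = \frac1{\sqrt{|B||C|}} \sum_{\substack{a\in A,\ b\in B\\ ab\in C}}\frac{\beta(c_0,ab)}{\beta(a_0,a)\beta(b_0,b)}\,\alpha(a,b),$$ where $a_0,b_0,c_0$ are the chosen representatives of $A,B,C$, respectively. For a function $\chi:G\to\mathbb{C}$ write $$v_\chi=\Big(\chi\big(c^{(1)}_0\big)\sqrt{|C^{(1)}|/|G|},\ \dots,\ \chi\big(c^{(m)}_0\big)\sqrt{|C^{(m)}|/|G|}\Big)^{T}\in\mathbb{C}^m .$$ (1) Let $\chi$ be the character of an irreducible projective representation of $G$ of degree $d$ with multiplier $\alpha$. Then for each $\alpha$-regular class $A$, with chosen representative $a_0$, $$M_A\, v_\chi = \frac{|A|\,\chi(a_0)}{d}\, v_\chi .$$ In other words, $v_\chi$ is a joint eigenvector of all the matrices $M_A$. (2) The matrices $M_A$ are normal and they commute with each other. They have exactly $m$ joint eigenvectors up to nonzero scalar factors, and $\chi\mapsto v_\chi$ gives a one-to-one correspondence between the distinct characters $\chi$ of irreducible projective representations of $G$ with multiplier $\alpha$ and these joint eigenvectors (up to scalar).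
   Context: A multiplier on $G$ is a function $\alpha:G\times G\to\mathbb{C}^\times$ with $\alpha(x,y)\alpha(xy,z)=\alpha(x,yz)\alpha(y,z)$ for all $x,y,z\in G$ and $\alpha(x,1)=\alpha(1,x)=1$ for all $x\in G$. It is unitary if there is a positive integer $N$ with $\alpha(x,y)^N=1$ for all $x,y\in G$. A projective representation $(\pi,V,\alpha)$ of $G$ over a finite-dimensional complex vector space $V\neq 0$ with multiplier $\alpha$ is a function $\pi:G\to\mathrm{GL}(V)$ with $\pi(x)\pi(y)=\alpha(x,y)\pi(xy)$ for all $x,y\in G$. Its degree is $\dim V$ and its character is $\chi(g)=\mathrm{tr}(\pi(g))$. It is irreducible if no nontrivial proper subspace of $V$ is invariant under all $\pi(g)$, $g\in G$. For $g,h\in G$ put $$\beta_h(g)=\frac{\alpha(h,h^{-1})}{\alpha(h,gh^{-1})\alpha(g,h^{-1})}=\frac{\alpha(h,h^{-1})}{\alpha(h,g)\alpha(hg,h^{-1})}$$ (the two expressions agree). An element $g\in G$ is $\alpha$-regular if $\beta_h(g)=1$ for all $h\in G$ with $gh=hg$. Conjugates of an $\alpha$-regular element are $\alpha$-regular, and a conjugacy class consisting of such elements is called $\alpha$-regular. If $g$ is $\alpha$-regular and $g'$ is conjugate to $g$, then $\beta(g,g'):=\beta_h(g)$ for any $h\in G$ with $g'=hgh^{-1}$; this does not depend on the choice of $h$. A joint eigenvector of a family of matrices is a nonzero vector that is an eigenvector of every matrix in the family. *)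

theory Defs
  imports
    "HOL-Algebra.Group"
    "HOL-Library.Function_Algebras"
    "Jordan_Normal_Form.Schur_Decomposition"
begin

section \<open>Multipliers\<close>

definition multiplier :: "('a, 'b) monoid_scheme \<Rightarrow> ('a \<Rightarrow> 'a \<Rightarrow> complex) \<Rightarrow> bool" where
  "multiplier G \<alpha> \<longleftrightarrow>
     (\<forall>x\<in>carrier G. \<forall>y\<in>carrier G. \<alpha> x y \<noteq> 0) \<and>
     (\<forall>x\<in>carrier G. \<forall>y\<in>carrier G. \<forall>z\<in>carrier G.
        \<alpha> x y * \<alpha> (x \<otimes>\<^bsub>G\<^esub> y) z = \<alpha> x (y \<otimes>\<^bsub>G\<^esub> z) * \<alpha> y z) \<and>
     (\<forall>x\<in>carrier G. \<alpha> x \<one>\<^bsub>G\<^esub> = 1 \<and> \<alpha> \<one>\<^bsub>G\<^esub> x = 1)"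

definition unitary_multiplier :: "('a, 'b) monoid_scheme \<Rightarrow> ('a \<Rightarrow> 'a \<Rightarrow> complex) \<Rightarrow> bool" where
  "unitary_multiplier G \<alpha> \<longleftrightarrow> multiplier G \<alpha> \<and>
     (\<exists>N::nat. N > 0 \<and> (\<forall>x\<in>carrier G. \<forall>y\<in>carrier G. \<alpha> x y ^ N = 1))"

section \<open>Regular classes\<close>

text \<open>\<open>beta_conj G \<alpha> h g\<close> is $\beta_h(g)$.\<close>

definition beta_conj :: "('a, 'b) monoid_scheme \<Rightarrow> ('a \<Rightarrow> 'a \<Rightarrow> complex) \<Rightarrow> 'a \<Rightarrow> 'a \<Rightarrow> complex" where
  "beta_conj G \<alpha> h g =
     \<alpha> h (inv\<^bsub>G\<^esub> h) / (\<alpha> h (g \<otimes>\<^bsub>G\<^esub> inv\<^bsub>G\<^esub> h) * \<alpha> g (inv\<^bsub>G\<^esub> h))"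

definition regular_elem :: "('a, 'b) monoid_scheme \<Rightarrow> ('a \<Rightarrow> 'a \<Rightarrow> complex) \<Rightarrow> 'a \<Rightarrow> bool" where
  "regular_elem G \<alpha> g \<longleftrightarrow> g \<in> carrier G \<and>
     (\<forall>h\<in>carrier G. g \<otimes>\<^bsub>G\<^esub> h = h \<otimes>\<^bsub>G\<^esub> g \<longrightarrow> beta_conj G \<alpha> h g = 1)"

definition conj_class :: "('a, 'b) monoid_scheme \<Rightarrow> 'a \<Rightarrow> 'a set" where
  "conj_class G g = {h \<otimes>\<^bsub>G\<^esub> g \<otimes>\<^bsub>G\<^esub> inv\<^bsub>G\<^esub> h | h. h \<in> carrier G}"

definition regular_classes :: "('a, 'b) monoid_scheme \<Rightarrow> ('a \<Rightarrow> 'a \<Rightarrow> complex) \<Rightarrow> 'a set set" where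
  "regular_classes G \<alpha> =
     {K. (\<exists>g\<in>carrier G. K = conj_class G g) \<and> (\<forall>x\<in>K. regular_elem G \<alpha> x)}"

text \<open>\<open>beta_pair G \<alpha> g g'\<close> is $\beta(g,g')$. It is only meaningful for a regular \<open>g\<close> and a
  conjugate \<open>g'\<close> of \<open>g\<close>; the value then does not depend on the chosen conjugating element.\<close>

definition beta_pair :: "('a, 'b) monoid_scheme \<Rightarrow> ('a \<Rightarrow> 'a \<Rightarrow> complex) \<Rightarrow> 'a \<Rightarrow> 'a \<Rightarrow> complex" where
  "beta_pair G \<alpha> g g' =
     beta_conj G \<alpha> (SOME h. h \<in> carrier G \<and> g' = h \<otimes>\<^bsub>G\<^esub> g \<otimes>\<^bsub>G\<^esub> inv\<^bsub>G\<^esub> h) g"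

section \<open>Projective representations\<close>

text \<open>A finite-dimensional complex vector space is given as a finite-dimensional subspace \<open>V\<close> of
  an arbitrary ambient complex vector space \<open>'v\<close> with scalar multiplication \<open>s\<close> (the ambient
  space itself is allowed). Maps are only constrained on \<open>V\<close>.\<close>

definition fin_dim_space :: "(complex \<Rightarrow> 'v::ab_group_add \<Rightarrow> 'v) \<Rightarrow> 'v set \<Rightarrow> bool" where
  "fin_dim_space s V \<longleftrightarrow> vector_space s \<and> Modules.module.subspace s V \<and>
     (\<exists>B. finite B \<and> Modules.module.span s B = V)"

definition general_linear :: "(complex \<Rightarrow> 'v::ab_group_add \<Rightarrow> 'v) \<Rightarrow> 'v set \<Rightarrow> ('v \<Rightarrow> 'v) set" where
  "general_linear s V = {T. bij_betw T V V \<and>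
     (\<forall>x\<in>V. \<forall>y\<in>V. T (x + y) = T x + T y) \<and> (\<forall>c. \<forall>x\<in>V. T (s c x) = s c (T x))}"

text \<open>The trace is the sum of the diagonal entries of the matrix with respect to some basis of
  \<open>V\<close>; all bases give the same value.\<close>

definition trace_on :: "(complex \<Rightarrow> 'v::ab_group_add \<Rightarrow> 'v) \<Rightarrow> 'v set \<Rightarrow> ('v \<Rightarrow> 'v) \<Rightarrow> complex" where
  "trace_on s V T =
     (let B = (SOME B. \<not> Modules.module.dependent s B \<and> Modules.module.span s B = V)
      in \<Sum>b\<in>B. Modules.module.representation s B (T b) b)"

definition proj_rep ::
  "('a, 'b) monoid_scheme \<Rightarrow> ('a \<Rightarrow> 'a \<Rightarrow> complex) \<Rightarrow> (complex \<Rightarrow> 'v::ab_group_add \<Rightarrow> 'v) \<Rightarrow>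
   'v set \<Rightarrow> ('a \<Rightarrow> 'v \<Rightarrow> 'v) \<Rightarrow> bool" where
  "proj_rep G \<alpha> s V \<pi> \<longleftrightarrow> fin_dim_space s V \<and> V \<noteq> {0} \<and>
     (\<forall>x\<in>carrier G. \<pi> x \<in> general_linear s V) \<and>
     (\<forall>x\<in>carrier G. \<forall>y\<in>carrier G. \<forall>v\<in>V. \<pi> x (\<pi> y v) = s (\<alpha> x y) (\<pi> (x \<otimes>\<^bsub>G\<^esub> y) v))"

definition irreducible_proj_rep ::
  "('a, 'b) monoid_scheme \<Rightarrow> ('a \<Rightarrow> 'a \<Rightarrow> complex) \<Rightarrow> (complex \<Rightarrow> 'v::ab_group_add \<Rightarrow> 'v) \<Rightarrow>
   'v set \<Rightarrow> ('a \<Rightarrow> 'v \<Rightarrow> 'v) \<Rightarrow> bool" where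
  "irreducible_proj_rep G \<alpha> s V \<pi> \<longleftrightarrow> proj_rep G \<alpha> s V \<pi> \<and>
     (\<forall>W. Modules.module.subspace s W \<and> W \<subseteq> V \<and> (\<forall>g\<in>carrier G. \<pi> g ` W \<subseteq> W) \<longrightarrow>
        W = {0} \<or> W = V)"

text \<open>Characters are extensional functions on the group, so that equality of characters is
  equality on the carrier.\<close>

definition rep_char ::
  "('a, 'b) monoid_scheme \<Rightarrow> (complex \<Rightarrow> 'v::ab_group_add \<Rightarrow> 'v) \<Rightarrow> 'v set \<Rightarrow>
   ('a \<Rightarrow> 'v \<Rightarrow> 'v) \<Rightarrow> 'a \<Rightarrow> complex" where
  "rep_char G s V \<pi> = (\<lambda>g\<in>carrier G. trace_on s V (\<pi> g))"

text \<open>A set of characters cannot be formed by quantifying over all types \<open>'v\<close>. The ambient space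
  of all complex sequences contains a copy of every finite-dimensional complex vector space.\<close>

definition seq_scale :: "complex \<Rightarrow> (nat \<Rightarrow> complex) \<Rightarrow> nat \<Rightarrow> complex" where
  "seq_scale c f = (\<lambda>n. c * f n)"

definition irr_chars :: "('a, 'b) monoid_scheme \<Rightarrow> ('a \<Rightarrow> 'a \<Rightarrow> complex) \<Rightarrow> ('a \<Rightarrow> complex) set" where
  "irr_chars G \<alpha> =
     {rep_char G seq_scale V \<pi> | V \<pi>. irreducible_proj_rep G \<alpha> seq_scale V \<pi>}"

section \<open>The matrices and vectors\<close>

text \<open>The classes are \<open>C 0, \<dots>, C (m - 1)\<close> with representatives \<open>c\<^sub>0 0, \<dots>, c\<^sub>0 (m - 1)\<close>. In
  \<open>class_mat\<close>, the index \<open>k\<close> is the one of the class $A$, and \<open>i\<close>, \<open>j\<close> are those of $B$, $C$.\<close>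

definition class_mat ::
  "('a, 'b) monoid_scheme \<Rightarrow> ('a \<Rightarrow> 'a \<Rightarrow> complex) \<Rightarrow> nat \<Rightarrow> (nat \<Rightarrow> 'a set) \<Rightarrow> (nat \<Rightarrow> 'a) \<Rightarrow>
   nat \<Rightarrow> complex mat" where
  "class_mat G \<alpha> m C c\<^sub>0 k = mat m m (\<lambda>(i, j).
     1 / complex_of_real (sqrt (real (card (C i)) * real (card (C j)))) *
     (\<Sum>(a, b) \<in> {(a, b). a \<in> C k \<and> b \<in> C i \<and> a \<otimes>\<^bsub>G\<^esub> b \<in> C j}.
        beta_pair G \<alpha> (c\<^sub>0 j) (a \<otimes>\<^bsub>G\<^esub> b) /
        (beta_pair G \<alpha> (c\<^sub>0 k) a * beta_pair G \<alpha> (c\<^sub>0 i) b) * \<alpha> a b))"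

definition char_vec ::
  "('a, 'b) monoid_scheme \<Rightarrow> nat \<Rightarrow> (nat \<Rightarrow> 'a set) \<Rightarrow> (nat \<Rightarrow> 'a) \<Rightarrow> ('a \<Rightarrow> complex) \<Rightarrow>
   complex vec" where
  "char_vec G m C c\<^sub>0 \<chi> = vec m (\<lambda>i.
     \<chi> (c\<^sub>0 i) * complex_of_real (sqrt (real (card (C i)) / real (card (carrier G)))))"

section \<open>Joint eigenvectors\<close>

definition joint_eigenvector :: "nat \<Rightarrow> complex mat set \<Rightarrow> complex vec \<Rightarrow> bool" where
  "joint_eigenvector m \<M> v \<longleftrightarrow> v \<in> carrier_vec m \<and> v \<noteq> 0\<^sub>v m \<and> (\<forall>M\<in>\<M>. \<exists>k. eigenvector M v k)"

definition scalar_class :: "complex vec \<Rightarrow> complex vec set" where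
  "scalar_class v = {c \<cdot>\<^sub>v v | c. c \<noteq> 0}"

definition joint_eigenlines :: "nat \<Rightarrow> complex mat set \<Rightarrow> complex vec set set" where
  "joint_eigenlines m \<M> = scalar_class ` {v. joint_eigenvector m \<M> v}"

definition normal_mat :: "complex mat \<Rightarrow> bool" where
  "normal_mat M \<longleftrightarrow> M * mat_adjoint M = mat_adjoint M * M"

end

theory Submission
  imports Defs "Jordan_Normal_Form.Spectral_Radius"
begin

text \<open>Let $e_x$ ($x \in G$) be the basis of the twisted group algebra, with $e_x e_y = \alpha(x,y) e_{xy}$;
its modules are the projective representations with multiplier $\alpha$. In it
$e_{hgh^{-1}} = \beta_h(g)\, e_h e_g e_h^{-1}$. Hence a character satisfies
$\chi(hgh^{-1}) = \beta_h(g)\chi(g)$, so it vanishes off the regular classes and is determined on a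
regular class by its value at the representative. For the same reason the elements
$z_A = \sum_{a \in A} \beta(a_0,a)^{-1} e_a$ are central. By Schur's lemma $z_A$ acts on an irreducible
module of degree $d$ as a scalar, and the trace shows that the scalar is $|A|\chi(a_0)/d$. Up to the
normalising square roots, $M_A$ is the matrix of multiplication by $z_A$ on the centre. Summing the
entries of row $B$ of $M_A$ against $v_\chi$ gives a multiple of the trace of $z_A z_B$, which is known
from the two scalars; this is the eigenvalue equation \<open>class_mat_eigen\<close>.

Everything else follows once the vectors $v_\chi$ are known to form an orthonormal basis of $\mathbb{C}^m$.

Orthonormality (\<open>char_vec_orthonormal\<close>) is Schur orthogonality. For matrix forms $P$ and $P'$ and any
matrix $L$ put $X = \sum_g P_g L P_g'^*$ and $H' = \sum_g P_g'^* P'_g$. Since $\alpha$ has modulus one,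
$P_h X P_h'^* = X$ and $P_h'^* H' P'_h = H'$, so $X H'$ intertwines $P'$ and $P$. Schur's lemma
determines $X H'$, and $H'$ is invertible. In this way no unitary basis has to be chosen.

Completeness (\<open>twisted_class_fun_complete\<close>, \<open>char_vec_complete\<close>): let $f$ satisfy
$f(hgh^{-1}) = \beta_h(g) f(g)$ and be orthogonal to all irreducible characters. Left multiplication
by the central element $\sum_g \overline{f(g)} e_g$ is a normal operator $T$ on the functions on $G$.
If $T \neq 0$, its range contains a minimal nonzero invariant subspace. On that irreducible module $T$ is a
scalar whose trace is zero by orthogonality, so $T$ kills it. But the range of a normal operator meets its
kernel only in zero. Hence $T = 0$ and $f = 0$.

So there are exactly $m$ irreducible characters, and the $M_A$ are diagonal in a common orthonormal
basis, which makes them normal and commuting. The eigenvalues $|A|\chi(a_0)/d$ for all $A$ determine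
$v_\chi$ up to a factor, so a joint eigenvector cannot have components along two different $v_\chi$
(\<open>joint_eigenvector_is_char_vec\<close>).\<close>

section \<open>The conjugation cocycle and regular elements\<close>

locale unitary_twist = group G for G (structure) +
  fixes \<alpha> :: "'a \<Rightarrow> 'a \<Rightarrow> complex"
  assumes finite_group: "finite (carrier G)"
    and unitary: "unitary_multiplier G \<alpha>"
begin

abbreviation "\<beta> \<equiv> beta_conj G \<alpha>"

lemma inv_cancel [simp]:
  assumes "x \<in> carrier G" "y \<in> carrier G"
  shows "inv x \<otimes> (x \<otimes> y) = y" "x \<otimes> (inv x \<otimes> y) = y"
  using assms by (simp_all add: m_assoc[symmetric])

lemma cocycle:
  "\<lbrakk>x \<in> carrier G; y \<in> carrier G; z \<in> carrier G\<rbrakk> \<Longrightarrow>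
    \<alpha> x y * \<alpha> (x \<otimes> y) z = \<alpha> x (y \<otimes> z) * \<alpha> y z"
  using unitary by (auto simp: unitary_multiplier_def multiplier_def)

lemma multiplier_one [simp]: "x \<in> carrier G \<Longrightarrow> \<alpha> x \<one> = 1" "x \<in> carrier G \<Longrightarrow> \<alpha> \<one> x = 1"
  using unitary by (auto simp: unitary_multiplier_def multiplier_def)

lemma multiplier_nonzero [simp]: "\<lbrakk>x \<in> carrier G; y \<in> carrier G\<rbrakk> \<Longrightarrow> \<alpha> x y \<noteq> 0"
  using unitary by (auto simp: unitary_multiplier_def multiplier_def)

lemma norm_multiplier [simp]:
  assumes "x \<in> carrier G" "y \<in> carrier G" shows "norm (\<alpha> x y) = 1"
proof -
  obtain N :: nat where "N > 0" "\<alpha> x y ^ N = 1"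
    using unitary assms by (auto simp: unitary_multiplier_def)
  then have "norm (\<alpha> x y) ^ N = 1" by (metis norm_one norm_power)
  with \<open>N > 0\<close> show ?thesis
    using power_eq_iff_eq_base[of N "norm (\<alpha> x y)" 1] by simp
qed

lemma multiplier_mult_cnj [simp]:
  assumes "x \<in> carrier G" "y \<in> carrier G"
  shows "\<alpha> x y * cnj (\<alpha> x y) = 1" "cnj (\<alpha> x y) * \<alpha> x y = 1"
  using assms by (simp_all add: complex_norm_square[symmetric] mult.commute)

lemma multiplier_inv_commute:
  assumes "h \<in> carrier G" shows "\<alpha> (inv h) h = \<alpha> h (inv h)"
  using cocycle[of h "inv h" h] assms by simp

text \<open>In the twisted group algebra this is the relation $e_{hgh^{-1}} e_h = \beta_h(g)\, e_h e_g$. It is the form in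
which $\beta$ enters all later computations.\<close>

lemma beta_times_multiplier:
  assumes g: "g \<in> carrier G" and h: "h \<in> carrier G"
  shows "\<beta> h g * \<alpha> h g = \<alpha> (h \<otimes> g \<otimes> inv h) h"
proof -
  have 1: "\<alpha> h g * \<alpha> (h \<otimes> g) (inv h) = \<alpha> h (g \<otimes> inv h) * \<alpha> g (inv h)"
    using cocycle[of h g "inv h"] g h by simp
  have 2: "\<alpha> (h \<otimes> g) (inv h) * \<alpha> (h \<otimes> g \<otimes> inv h) h = \<alpha> h (inv h)"
    using cocycle[of "h \<otimes> g" "inv h" h] multiplier_inv_commute[OF h] g h by simp
  show ?thesis
    unfolding beta_conj_def 1[symmetric] 2[symmetric] using g h by simp
qed

lemma beta_conj_eq:
  assumes "g \<in> carrier G" "h \<in> carrier G"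
  shows "\<beta> h g = \<alpha> (h \<otimes> g \<otimes> inv h) h / \<alpha> h g"
  using beta_times_multiplier[OF assms] assms by (simp add: field_simps)

lemma norm_beta [simp]:
  assumes "g \<in> carrier G" "h \<in> carrier G" shows "norm (\<beta> h g) = 1"
  using assms by (simp add: beta_conj_eq norm_divide)

lemma beta_nonzero [simp]:
  assumes "g \<in> carrier G" "h \<in> carrier G" shows "\<beta> h g \<noteq> 0"
  using norm_beta[OF assms] by auto

text \<open>Conjugation by $hk$ is conjugation by $k$ followed by conjugation by $h$; comparing the factors in the
twisted group algebra gives this cocycle identity. The proof combines three instances of the identity for
$\alpha$.\<close>

lemma beta_mult:
  assumes g: "g \<in> carrier G" and h: "h \<in> carrier G" and k: "k \<in> carrier G"
  shows "\<beta> (h \<otimes> k) g = \<beta> h (k \<otimes> g \<otimes> inv k) * \<beta> k g"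
proof -
  define g' where "g' = k \<otimes> g \<otimes> inv k"
  define g'' where "g'' = h \<otimes> g' \<otimes> inv h"
  have c: "g' \<in> carrier G" "g'' \<in> carrier G" using g h k by (auto simp: g'_def g''_def)
  have e: "g'' \<otimes> h = h \<otimes> g'" "g' \<otimes> k = k \<otimes> g"
    using g h k c by (simp_all add: g''_def g'_def m_assoc)
  have e3: "(h \<otimes> k) \<otimes> g \<otimes> inv (h \<otimes> k) = g''"
    using g h k by (simp add: g''_def g'_def m_assoc inv_mult_group)
  have 1: "\<alpha> g'' h * \<alpha> (h \<otimes> g') k = \<alpha> g'' (h \<otimes> k) * \<alpha> h k"
    using cocycle[of g'' h k] c h k by (simp add: e)
  have 2: "\<alpha> h g' * \<alpha> (h \<otimes> g') k = \<alpha> h (k \<otimes> g) * \<alpha> g' k"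
    using cocycle[of h g' k] c h k by (simp add: e)
  have 3: "\<alpha> h k * \<alpha> (h \<otimes> k) g = \<alpha> h (k \<otimes> g) * \<alpha> k g"
    using cocycle[of h k g] g h k by simp
  have "\<alpha> h k * \<alpha> (h \<otimes> g') k * (\<alpha> g'' (h \<otimes> k) * (\<alpha> h g' * \<alpha> k g))
      = (\<alpha> g'' (h \<otimes> k) * \<alpha> h k) * (\<alpha> h g' * \<alpha> (h \<otimes> g') k) * \<alpha> k g"
    by (simp only: mult_ac)
  also have "\<dots> = (\<alpha> g'' h * \<alpha> (h \<otimes> g') k) * \<alpha> g' k * (\<alpha> h (k \<otimes> g) * \<alpha> k g)"
    unfolding 1[symmetric] 2 by (simp only: mult_ac)
  also have "\<dots> = \<alpha> h k * \<alpha> (h \<otimes> g') k * (\<alpha> g'' h * \<alpha> g' k * \<alpha> (h \<otimes> k) g)"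
    unfolding 3[symmetric] by (simp only: mult_ac)
  finally have "\<alpha> h k * \<alpha> (h \<otimes> g') k * (\<alpha> g'' (h \<otimes> k) * (\<alpha> h g' * \<alpha> k g))
      = \<alpha> h k * \<alpha> (h \<otimes> g') k * (\<alpha> g'' h * \<alpha> g' k * \<alpha> (h \<otimes> k) g)" .
  then have 4: "\<alpha> g'' (h \<otimes> k) * (\<alpha> h g' * \<alpha> k g) = \<alpha> g'' h * \<alpha> g' k * \<alpha> (h \<otimes> k) g"
    using c h k by simp
  have "\<beta> (h \<otimes> k) g = \<alpha> g'' (h \<otimes> k) / \<alpha> (h \<otimes> k) g"
    using beta_conj_eq[of g "h \<otimes> k"] g h k unfolding e3 by simp
  also have "\<dots> = (\<alpha> g'' h / \<alpha> h g') * (\<alpha> g' k / \<alpha> k g)"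
    using 4 c g h k by (simp add: field_simps)
  also have "\<dots> = \<beta> h g' * \<beta> k g"
    using c g h k beta_conj_eq[of g' h] beta_conj_eq[of g k]
    by (simp add: g'_def[symmetric] g''_def[symmetric])
  finally show ?thesis unfolding g'_def .
qed

lemma regular_carrier: "regular_elem G \<alpha> g \<Longrightarrow> g \<in> carrier G"
  by (simp add: regular_elem_def)

text \<open>Two elements that conjugate $g$ to the same element differ by an element of the centraliser of $g$, and
there $\beta$ is trivial by regularity.\<close>

lemma beta_conj_well_defined:
  assumes g: "regular_elem G \<alpha> g" and h: "h \<in> carrier G" and k: "k \<in> carrier G"
    and eq: "h \<otimes> g \<otimes> inv h = k \<otimes> g \<otimes> inv k"
  shows "\<beta> h g = \<beta> k g"
proof -
  define u where "u = inv k \<otimes> h"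
  have gc: "g \<in> carrier G" and u: "u \<in> carrier G"
    using regular_carrier[OF g] h k by (auto simp: u_def)
  have h_eq: "h = k \<otimes> u" using h k by (simp add: u_def m_assoc[symmetric])
  have "u \<otimes> g = inv k \<otimes> (h \<otimes> g \<otimes> inv h) \<otimes> h"
    using gc h k by (simp add: u_def m_assoc)
  also have "\<dots> = g \<otimes> u"
    unfolding eq using gc h k by (simp add: u_def m_assoc[symmetric])
  finally have comm: "u \<otimes> g = g \<otimes> u" .
  then have "u \<otimes> g \<otimes> inv u = g" using gc u by (simp add: m_assoc)
  moreover have "\<beta> u g = 1" using g comm u by (auto simp: regular_elem_def)
  ultimately show ?thesis using beta_mult[OF gc k u] by (simp add: h_eq)
qed

lemma regular_conj:
  assumes g: "regular_elem G \<alpha> g" and k: "k \<in> carrier G"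
  shows "regular_elem G \<alpha> (k \<otimes> g \<otimes> inv k)"
proof -
  have gc: "g \<in> carrier G" using regular_carrier[OF g] .
  have "\<beta> h (k \<otimes> g \<otimes> inv k) = 1"
    if h: "h \<in> carrier G" and c: "k \<otimes> g \<otimes> inv k \<otimes> h = h \<otimes> (k \<otimes> g \<otimes> inv k)" for h
  proof -
    have 1: "h \<otimes> k \<otimes> g \<otimes> inv (h \<otimes> k) = (h \<otimes> (k \<otimes> g \<otimes> inv k)) \<otimes> inv h"
      using gc k h by (simp add: m_assoc inv_mult_group)
    have "(k \<otimes> g \<otimes> inv k \<otimes> h) \<otimes> inv h = k \<otimes> g \<otimes> inv k"
      using gc k h by (simp add: m_assoc)
    then have "h \<otimes> k \<otimes> g \<otimes> inv (h \<otimes> k) = k \<otimes> g \<otimes> inv k"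
      by (simp only: 1 c)
    then have "\<beta> (h \<otimes> k) g = \<beta> k g"
      by (rule beta_conj_well_defined[OF g m_closed[OF h k] k])
    then show ?thesis using beta_mult[OF gc h k] gc k by simp
  qed
  then show ?thesis using gc k by (auto simp: regular_elem_def)
qed

lemma beta_pair_conj:
  assumes g: "regular_elem G \<alpha> g" and h: "h \<in> carrier G"
  shows "beta_pair G \<alpha> g (h \<otimes> g \<otimes> inv h) = \<beta> h g"
proof -
  define k where "k = (SOME k. k \<in> carrier G \<and> h \<otimes> g \<otimes> inv h = k \<otimes> g \<otimes> inv k)"
  have "k \<in> carrier G \<and> h \<otimes> g \<otimes> inv h = k \<otimes> g \<otimes> inv k"
    unfolding k_def by (rule someI[of _ h]) (simp add: h)
  then have "\<beta> h g = \<beta> k g" using beta_conj_well_defined[OF g h, of k] by blast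
  then show ?thesis unfolding beta_pair_def k_def by simp
qed

lemma conj_class_self: "g \<in> carrier G \<Longrightarrow> g \<in> conj_class G g"
  unfolding conj_class_def by (rule CollectI, rule exI[of _ \<one>]) auto

lemma conj_class_eq:
  assumes g: "g \<in> carrier G" and x: "x \<in> conj_class G g"
  shows "conj_class G x = conj_class G g"
proof -
  obtain k where k: "k \<in> carrier G" "x = k \<otimes> g \<otimes> inv k" using x by (auto simp: conj_class_def)
  have *: "conj_class G (k \<otimes> g \<otimes> inv k) \<subseteq> conj_class G g" if "k \<in> carrier G" "g \<in> carrier G" for k g
  proof
    fix y assume "y \<in> conj_class G (k \<otimes> g \<otimes> inv k)"
    then obtain h where "h \<in> carrier G" "y = h \<otimes> (k \<otimes> g \<otimes> inv k) \<otimes> inv h"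
      by (auto simp: conj_class_def)
    then have "y = (h \<otimes> k) \<otimes> g \<otimes> inv (h \<otimes> k)" "h \<otimes> k \<in> carrier G"
      using that by (simp_all add: m_assoc inv_mult_group)
    then show "y \<in> conj_class G g" unfolding conj_class_def by blast
  qed
  have "g = inv k \<otimes> x \<otimes> inv (inv k)" using g k by (simp add: m_assoc)
  then have "conj_class G g \<subseteq> conj_class G x" using *[of "inv k" x] g k by simp
  with *[OF k(1) g] k(2) show ?thesis by auto
qed

lemma regular_class_of_regular:
  assumes "regular_elem G \<alpha> g" shows "conj_class G g \<in> regular_classes G \<alpha>"
  using assms regular_conj[OF assms] regular_carrier[OF assms]
  unfolding regular_classes_def by (auto simp: conj_class_def)

end

section \<open>Matrix form of irreducible projective representations\<close>

text \<open>The operators of a representation are only constrained on the space $V$, so linearity has to be relative to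
$V$ as well.\<close>

definition endo_on :: "(complex \<Rightarrow> 'v::ab_group_add \<Rightarrow> 'v) \<Rightarrow> 'v set \<Rightarrow> ('v \<Rightarrow> 'v) \<Rightarrow> bool" where
  "endo_on s V T \<longleftrightarrow> (\<forall>x\<in>V. T x \<in> V) \<and> (\<forall>x\<in>V. \<forall>y\<in>V. T (x + y) = T x + T y) \<and>
     (\<forall>c. \<forall>x\<in>V. T (s c x) = s c (T x))"

lemma endo_on_zero:
  assumes vs: "vector_space s" and T: "endo_on s V T" and V: "Modules.module.subspace s V" shows "T 0 = 0"
proof -
  interpret vector_space s by fact
  have "0 \<in> V" using subspace_0[OF V] .
  then have "T (s 0 0) = s 0 (T 0)" using T unfolding endo_on_def by blast
  then show ?thesis by simp
qed

lemma endo_on_sum: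
  assumes vs: "vector_space s" and T: "endo_on s V T" and V: "Modules.module.subspace s V"
    and x: "\<And>i. i \<in> I \<Longrightarrow> x i \<in> V"
  shows "T (\<Sum>i\<in>I. s (c i) (x i)) = (\<Sum>i\<in>I. s (c i) (T (x i)))"
  using x
proof (induction I rule: infinite_finite_induct)
  case (insert a F)
  interpret vector_space s by fact
  have "(\<Sum>i\<in>F. s (c i) (x i)) \<in> V" "s (c a) (x a) \<in> V"
    using insert V by (auto intro!: subspace_sum subspace_scale)
  with insert T show ?case by (simp add: endo_on_def)
qed (auto simp: endo_on_zero[OF vs T V])

context vector_space
begin

lemma representation_lincomb:
  assumes "independent B" "\<And>i. i \<in> I \<Longrightarrow> x i \<in> span B"
  shows "representation B (\<Sum>i\<in>I. scale (c i) (x i)) b = (\<Sum>i\<in>I. c i * representation B (x i) b)"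
  using assms by (subst representation_sum) (auto simp: representation_scale span_scale intro!: sum.cong)

lemma finite_basis_of_span:
  assumes "finite S" obtains B where "finite B" "independent B" "span B = span S"
proof -
  obtain B where B: "B \<subseteq> S" "independent B" "S \<subseteq> span B"
    using maximal_independent_subset[of S] by blast
  then have "span B = span S" by (metis span_mono span_span subset_antisym)
  with B assms that show ?thesis by (metis finite_subset)
qed

end

text \<open>The trace is taken with respect to an unspecified basis. Expanding that basis in the vectors
\<open>e i\<close> and these back in the basis cancels the two changes of coordinates, so any basis may be used to
compute it.\<close>

lemma trace_on_eq_coordinates:
  fixes s :: "complex \<Rightarrow> 'v::ab_group_add \<Rightarrow> 'v"
  assumes vs: "vector_space s"
    and inj: "inj_on e {..<d::nat}"
    and ind: "\<not> Modules.module.dependent s (e ` {..<d})"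
    and sp: "Modules.module.span s (e ` {..<d}) = V"
    and T: "endo_on s V T"
    and X: "\<And>j. j < d \<Longrightarrow> T (e j) = (\<Sum>i<d. s (X i j) (e i))"
  shows "trace_on s V T = (\<Sum>i<d. X i i)"
proof -
  interpret vector_space s by fact
  define co where "co v i = representation (e ` {..<d}) v (e i)" for v i
  define B where "B = (SOME B. independent B \<and> span B = V)"
  have "independent B \<and> span B = V"
    unfolding B_def by (rule someI[of _ "e ` {..<d}"]) (simp add: ind sp)
  then have B: "independent B" "span B = V" by auto
  have subV: "subspace V" using sp by auto
  have "B \<subseteq> span (e ` {..<d})" unfolding sp using B(2) span_superset by auto
  then have finB: "finite B" using independent_span_bound[of "e ` {..<d}" B] B by auto
  have eV: "e i \<in> V" if "i < d" for i using that sp span_superset[of "e ` {..<d}"] by auto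
  have BV: "b \<in> V" if "b \<in> B" for b using that B(2) span_superset[of B] by auto
  have exp_e: "v = (\<Sum>i<d. s (co v i) (e i))" if "v \<in> V" for v
  proof -
    have "v = (\<Sum>b\<in>e ` {..<d}. s (representation (e ` {..<d}) v b) b)"
      using sum_representation_eq[OF ind _ _ order_refl, of v] that sp by simp
    also have "\<dots> = (\<Sum>i<d. s (co v i) (e i))" by (simp add: sum.reindex[OF inj] co_def)
    finally show ?thesis .
  qed
  have exp_B: "v = (\<Sum>b\<in>B. s (representation B v b) b)" if "v \<in> V" for v
    using sum_representation_eq[OF B(1) _ finB order_refl, of v] that B(2) by simp
  have "representation B (T b) b = (\<Sum>i<d. \<Sum>k<d. X k i * (representation B (e k) b * co b i))"
    if b: "b \<in> B" for b
  proof -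
    have "T b = T (\<Sum>i<d. s (co b i) (e i))" using exp_e[OF BV[OF b]] by simp
    also have "\<dots> = (\<Sum>i<d. s (co b i) (T (e i)))"
      by (rule endo_on_sum[OF vector_space_axioms T subV]) (simp add: eV)
    finally have "T b = (\<Sum>i<d. s (co b i) (T (e i)))" .
    then have "representation B (T b) b = (\<Sum>i<d. co b i * representation B (T (e i)) b)"
      using T eV by (subst representation_lincomb[OF B(1), symmetric]) (auto simp: B(2) endo_on_def)
    also have "\<dots> = (\<Sum>i<d. co b i * (\<Sum>k<d. X k i * representation B (e k) b))"
      by (intro sum.cong refl arg_cong2[where f="(*)"])
         (auto simp: X eV B(2) intro!: representation_lincomb[OF B(1)])
    finally show ?thesis by (simp add: sum_distrib_left mult_ac)
  qed
  then have "(\<Sum>b\<in>B. representation B (T b) b)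
      = (\<Sum>b\<in>B. \<Sum>i<d. \<Sum>k<d. X k i * (representation B (e k) b * co b i))" by simp
  also have "\<dots> = (\<Sum>i<d. \<Sum>b\<in>B. \<Sum>k<d. X k i * (representation B (e k) b * co b i))"
    by (rule sum.swap)
  also have "\<dots> = (\<Sum>i<d. \<Sum>k<d. \<Sum>b\<in>B. X k i * (representation B (e k) b * co b i))"
    by (intro sum.cong refl sum.swap)
  also have "\<dots> = (\<Sum>i<d. \<Sum>k<d. X k i * co (e k) i)"
  proof (intro sum.cong refl)
    fix i k assume "i \<in> {..<d}" "k \<in> {..<d}"
    then have "e k = (\<Sum>b\<in>B. s (representation B (e k) b) b)" using exp_B eV by auto
    then have "co (e k) i = co (\<Sum>b\<in>B. s (representation B (e k) b) b) i" by simp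
    also have "\<dots> = (\<Sum>b\<in>B. representation B (e k) b * co b i)"
      unfolding co_def using BV by (intro representation_lincomb[OF ind]) (auto simp: sp)
    finally show "(\<Sum>b\<in>B. X k i * (representation B (e k) b * co b i)) = X k i * co (e k) i"
      by (simp add: sum_distrib_left)
  qed
  also have "\<dots> = (\<Sum>i<d. \<Sum>k<d. if k = i then X k i else 0)"
  proof (intro sum.cong refl)
    fix i k assume "i \<in> {..<d}" "k \<in> {..<d}"
    then show "X k i * co (e k) i = (if k = i then X k i else 0)"
      using inj by (auto simp: co_def representation_basis[OF ind] inj_on_def)
  qed
  also have "\<dots> = (\<Sum>i<d. X i i)" by simp
  finally show ?thesis unfolding trace_on_def Let_def B_def .
qed

context unitary_twist
begin

text \<open>The matrices of an irreducible projective representation; only the entries with indices below \<open>d\<close> matter.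
Irreducibility is expressed by every nonzero vector being cyclic, which is how Schur's lemma uses it.\<close>

definition irr_mat :: "nat \<Rightarrow> ('a \<Rightarrow> nat \<Rightarrow> nat \<Rightarrow> complex) \<Rightarrow> bool" where
  "irr_mat d P \<longleftrightarrow> 0 < d \<and>
     (\<forall>i<d. \<forall>j<d. P \<one> i j = (if i = j then 1 else 0)) \<and>
     (\<forall>x\<in>carrier G. \<forall>y\<in>carrier G. \<forall>i<d. \<forall>j<d.
        (\<Sum>k<d. P x i k * P y k j) = \<alpha> x y * P (x \<otimes> y) i j) \<and>
     (\<forall>v w. (\<exists>i<d. v i \<noteq> 0) \<longrightarrow>
        (\<exists>c. \<forall>i<d. w i = (\<Sum>g\<in>carrier G. c g * (\<Sum>j<d. P g i j * v j))))"

definition mat_char :: "nat \<Rightarrow> ('a \<Rightarrow> nat \<Rightarrow> nat \<Rightarrow> complex) \<Rightarrow> 'a \<Rightarrow> complex" where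
  "mat_char d P = (\<lambda>g\<in>carrier G. \<Sum>i<d. P g i i)"

lemma sum_shift:
  fixes f :: "'a \<Rightarrow> 'c::comm_monoid_add"
  assumes "h \<in> carrier G"
  shows "(\<Sum>g\<in>carrier G. f (h \<otimes> g)) = (\<Sum>g\<in>carrier G. f g)"
  by (rule sum.reindex_bij_witness[where i="\<lambda>g. inv h \<otimes> g" and j="\<lambda>g. h \<otimes> g"])
     (use assms in auto)

text \<open>For $v \neq 0$ the combinations of the vectors $\pi(g) v$ form an invariant subspace that contains
$v = \pi(1) v$, so by irreducibility it is all of $V$: every nonzero vector is cyclic. The last conclusion
carries an identity between matrices back to the operators on $V$.\<close>

lemma irreducible_proj_rep_matrix_form:
  fixes s :: "complex \<Rightarrow> 'v::ab_group_add \<Rightarrow> 'v"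
  assumes irr: "irreducible_proj_rep G \<alpha> s V \<pi>"
  obtains P where "irr_mat (vector_space.dim s V) P"
    and "rep_char G s V \<pi> = mat_char (vector_space.dim s V) P"
    and "\<And>z w. \<lbrakk>w \<in> V; \<And>i j. \<lbrakk>i < vector_space.dim s V; j < vector_space.dim s V\<rbrakk> \<Longrightarrow>
           (\<Sum>g\<in>carrier G. z g * P g i j) = 0\<rbrakk> \<Longrightarrow> (\<Sum>g\<in>carrier G. s (z g) (\<pi> g w)) = 0"
proof -
  have rep: "proj_rep G \<alpha> s V \<pi>" using irr by (simp add: irreducible_proj_rep_def)
  then have fd: "fin_dim_space s V" by (simp add: proj_rep_def)
  then interpret vector_space s by (simp add: fin_dim_space_def)
  have subV: "subspace V" using fd by (simp add: fin_dim_space_def)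
  obtain S where "finite S" "span S = V" using fd by (auto simp: fin_dim_space_def)
  then obtain B where B: "finite B" "independent B" "span B = V"
    by (metis finite_basis_of_span)
  define d where "d = dim V"
  have "card B = d" unfolding d_def using dim_eq_card[of B V] B by (metis span_span)
  then obtain e where e: "bij_betw e {..<d} B"
    using ex_bij_betw_nat_finite[OF B(1)] by (auto simp: atLeast0LessThan)
  have inj: "inj_on e {..<d}" and im: "e ` {..<d} = B" using e by (auto simp: bij_betw_def)
  have BV: "b \<in> V" if "b \<in> B" for b using that B(3) span_superset[of B] by auto
  have eB: "e i \<in> B" if "i < d" for i using im that by auto
  have eV: "e i \<in> V" if "i < d" for i using BV eB that by auto
  define co where "co v i = representation B v (e i)" for v i
  have expand: "v = (\<Sum>i<d. s (co v i) (e i))" if "v \<in> V" for v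
  proof -
    have "v = (\<Sum>b\<in>B. s (representation B v b) b)"
      using sum_representation_eq[OF B(2) _ B(1) order_refl, of v] that B(3) by simp
    also have "\<dots> = (\<Sum>i<d. s (co v i) (e i))"
      by (simp add: im[symmetric] sum.reindex[OF inj] co_def)
    finally show ?thesis .
  qed
  have co_lincomb: "co (\<Sum>a\<in>I. s (c a) (x a)) i = (\<Sum>a\<in>I. c a * co (x a) i)"
    if "\<And>a. a \<in> I \<Longrightarrow> x a \<in> V" for I :: "nat set" and c x i
    unfolding co_def using that by (intro representation_lincomb[OF B(2)]) (auto simp: B(3))
  have co_lincomb_group: "co (\<Sum>a\<in>I. s (c a) (x a)) i = (\<Sum>a\<in>I. c a * co (x a) i)"
    if "\<And>a. a \<in> I \<Longrightarrow> x a \<in> V" for I :: "'a set" and c x i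
    unfolding co_def using that by (intro representation_lincomb[OF B(2)]) (auto simp: B(3))
  have co_e: "co (e j) i = (if i = j then 1 else 0)" if "i < d" "j < d" for i j
    using that inj eB by (auto simp: co_def representation_basis[OF B(2)] inj_on_def)
  have endo: "endo_on s V (\<pi> g)" if "g \<in> carrier G" for g
  proof -
    have "\<pi> g \<in> general_linear s V" using rep that by (simp add: proj_rep_def)
    then show ?thesis by (auto simp: general_linear_def endo_on_def bij_betw_def)
  qed
  have piV: "\<pi> g v \<in> V" if "g \<in> carrier G" "v \<in> V" for g v
    using endo that by (auto simp: endo_on_def)
  have mult: "\<pi> x (\<pi> y v) = s (\<alpha> x y) (\<pi> (x \<otimes> y) v)"
    if "x \<in> carrier G" "y \<in> carrier G" "v \<in> V" for x y v
    using rep that by (auto simp: proj_rep_def)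
  have one: "\<pi> \<one> v = v" if "v \<in> V" for v
  proof -
    have "inj_on (\<pi> \<one>) V"
      using rep by (auto simp: proj_rep_def general_linear_def bij_betw_def)
    moreover have "\<pi> \<one> (\<pi> \<one> v) = \<pi> \<one> v" using mult[of \<one> \<one> v] that by simp
    ultimately show ?thesis using that piV by (auto simp: inj_on_def)
  qed
  define P where "P g i j = co (\<pi> g (e j)) i" for g i j
  have co_pi: "co (\<pi> g v) i = (\<Sum>j<d. P g i j * co v j)" if "g \<in> carrier G" "v \<in> V" for g v i
  proof -
    have "\<pi> g v = \<pi> g (\<Sum>j<d. s (co v j) (e j))" using expand that by simp
    also have "\<dots> = (\<Sum>j<d. s (co v j) (\<pi> g (e j)))"
      by (rule endo_on_sum[OF vector_space_axioms endo subV]) (use that eV in auto)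
    finally have "co (\<pi> g v) i = co (\<Sum>j<d. s (co v j) (\<pi> g (e j))) i" by simp
    also have "\<dots> = (\<Sum>j<d. co v j * co (\<pi> g (e j)) i)"
      by (rule co_lincomb) (use that piV eV in auto)
    finally show ?thesis by (simp add: P_def mult.commute)
  qed
  have chi: "rep_char G s V \<pi> = mat_char d P"
  proof -
    have "trace_on s V (\<pi> g) = (\<Sum>i<d. P g i i)" if "g \<in> carrier G" for g
    proof (rule trace_on_eq_coordinates[OF vector_space_axioms inj, where X="P g"])
      show "\<pi> g (e j) = (\<Sum>i<d. s (P g i j) (e i))" if "j < d" for j
        unfolding P_def using that eV piV \<open>g \<in> carrier G\<close> by (intro expand) auto
    qed (use B im endo that in auto)
    then show ?thesis by (auto simp: rep_char_def mat_char_def)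
  qed
  have irrP: "irr_mat d P" unfolding irr_mat_def
  proof (intro conjI allI impI ballI)
    have "B \<noteq> {}"
    proof
      assume "B = {}"
      then have "V = {0}" using B(3) by simp
      then show False using rep by (simp add: proj_rep_def)
    qed
    then show "0 < d" using \<open>card B = d\<close> B(1) by (auto simp: card_gt_0_iff)
  next
    fix i j assume "i < d" "j < d"
    then show "P \<one> i j = (if i = j then 1 else 0)" by (simp add: P_def one eV co_e)
  next
    fix x y i j assume *: "x \<in> carrier G" "y \<in> carrier G" "i < d" "j < d"
    have "(\<Sum>k<d. P x i k * P y k j) = co (\<pi> x (\<pi> y (e j))) i"
      using * co_pi[of x "\<pi> y (e j)" i] piV eV by (simp add: P_def)
    also have "\<dots> = co (s (\<alpha> x y) (\<pi> (x \<otimes> y) (e j))) i" using mult * eV by simp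
    also have "\<dots> = \<alpha> x y * P (x \<otimes> y) i j"
      using co_lincomb[of "{0}" "\<lambda>_. \<pi> (x \<otimes> y) (e j)" "\<lambda>_. \<alpha> x y" i] piV eV * by (simp add: P_def)
    finally show "(\<Sum>k<d. P x i k * P y k j) = \<alpha> x y * P (x \<otimes> y) i j" .
  next
    fix v w :: "nat \<Rightarrow> complex" assume "\<exists>i<d. v i \<noteq> 0"
    then obtain i0 where i0: "i0 < d" "v i0 \<noteq> 0" by blast
    have co_comb: "co (\<Sum>j<d. s (u j) (e j)) i = u i" if "i < d" for u i
    proof -
      have "co (\<Sum>j<d. s (u j) (e j)) i = (\<Sum>j<d. u j * co (e j) i)"
        by (rule co_lincomb) (simp add: eV)
      also have "\<dots> = (\<Sum>j<d. if j = i then u j else 0)"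
        using that by (intro sum.cong) (auto simp: co_e)
      finally show ?thesis using that by simp
    qed
    have combV: "(\<Sum>j<d. s (u j) (e j)) \<in> V" for u
      using eV subV by (auto intro!: subspace_sum subspace_scale)
    define v' where "v' = (\<Sum>j<d. s (v j) (e j))"
    have v': "v' \<in> V" "\<And>i. i < d \<Longrightarrow> co v' i = v i" using combV co_comb by (auto simp: v'_def)
    \<comment> \<open>the submodule generated by \<open>v'\<close>\<close>
    define U where "U = range (\<lambda>c. \<Sum>g\<in>carrier G. s (c g) (\<pi> g v'))"
    have subU: "subspace U"
    proof (rule subspaceI)
      show "0 \<in> U" unfolding U_def by (rule range_eqI[of _ _ "\<lambda>_. 0"]) simp
    next
      fix x y assume "x \<in> U" "y \<in> U"
      then obtain c c' where "x = (\<Sum>g\<in>carrier G. s (c g) (\<pi> g v'))"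
        "y = (\<Sum>g\<in>carrier G. s (c' g) (\<pi> g v'))" by (auto simp: U_def)
      then have "x + y = (\<Sum>g\<in>carrier G. s (c g + c' g) (\<pi> g v'))"
        by (simp add: scale_left_distrib sum.distrib)
      then show "x + y \<in> U" by (auto simp: U_def)
    next
      fix a x assume "x \<in> U"
      then obtain c where "x = (\<Sum>g\<in>carrier G. s (c g) (\<pi> g v'))" by (auto simp: U_def)
      then have "s a x = (\<Sum>g\<in>carrier G. s (a * c g) (\<pi> g v'))"
        by (simp add: scale_sum_right)
      then show "s a x \<in> U" by (auto simp: U_def)
    qed
    have UV: "U \<subseteq> V"
      using piV v' subV by (auto simp: U_def intro!: subspace_sum subspace_scale)
    have invU: "\<pi> h ` U \<subseteq> U" if h: "h \<in> carrier G" for h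
    proof
      fix y assume "y \<in> \<pi> h ` U"
      then obtain c where "y = \<pi> h (\<Sum>g\<in>carrier G. s (c g) (\<pi> g v'))" by (auto simp: U_def)
      also have "\<dots> = (\<Sum>g\<in>carrier G. s (c g) (\<pi> h (\<pi> g v')))"
        by (rule endo_on_sum[OF vector_space_axioms endo[OF h] subV]) (use piV v' in auto)
      also have "\<dots> = (\<Sum>g\<in>carrier G. s (c (inv h \<otimes> (h \<otimes> g)) * \<alpha> h (inv h \<otimes> (h \<otimes> g))) (\<pi> (h \<otimes> g) v'))"
        using h v' by (intro sum.cong refl) (simp add: mult)
      also have "\<dots> = (\<Sum>g\<in>carrier G. s (c (inv h \<otimes> g) * \<alpha> h (inv h \<otimes> g)) (\<pi> g v'))"
        by (rule sum_shift[OF h, of "\<lambda>g. s (c (inv h \<otimes> g) * \<alpha> h (inv h \<otimes> g)) (\<pi> g v')"])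
      finally show "y \<in> U" by (auto simp: U_def)
    qed
    have v'U: "v' \<in> U"
    proof -
      have "(\<Sum>g\<in>carrier G. s (if g = \<one> then 1 else 0) (\<pi> g v'))
          = (\<Sum>g\<in>carrier G. if g = \<one> then v' else 0)"
        using v' by (intro sum.cong refl) (auto simp: one)
      also have "\<dots> = v'" using finite_group by simp
      finally show ?thesis
        unfolding U_def by (intro range_eqI[where x="\<lambda>g. if g = \<one> then 1 else 0"]) simp
    qed
    have v'0: "v' \<noteq> 0"
    proof
      assume "v' = 0"
      then have "co v' i0 = 0" by (simp add: co_def representation_zero)
      then show False using i0 v' by simp
    qed
    have "U = {0} \<or> U = V"
      using irr subU UV invU unfolding irreducible_proj_rep_def by simp
    then have "U = V" using v'U v'0 by auto
    then have "(\<Sum>j<d. s (w j) (e j)) \<in> U" using combV by simp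
    then obtain c where c: "(\<Sum>j<d. s (w j) (e j)) = (\<Sum>g\<in>carrier G. s (c g) (\<pi> g v'))"
      by (auto simp: U_def)
    have "w i = (\<Sum>g\<in>carrier G. c g * (\<Sum>j<d. P g i j * v j))" if i: "i < d" for i
    proof -
      have "w i = co (\<Sum>g\<in>carrier G. s (c g) (\<pi> g v')) i" using co_comb[OF i, of w] c by simp
      also have "\<dots> = (\<Sum>g\<in>carrier G. c g * co (\<pi> g v') i)"
        by (rule co_lincomb_group) (use piV v' in auto)
      also have "\<dots> = (\<Sum>g\<in>carrier G. c g * (\<Sum>j<d. P g i j * v j))"
        using v' by (intro sum.cong refl) (simp add: co_pi)
      finally show ?thesis .
    qed
    then show "\<exists>c. \<forall>i<d. w i = (\<Sum>g\<in>carrier G. c g * (\<Sum>j<d. P g i j * v j))" by blast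
  qed
  have zero: "(\<Sum>g\<in>carrier G. s (z g) (\<pi> g w)) = 0"
    if w: "w \<in> V" and z: "\<And>i j. \<lbrakk>i < d; j < d\<rbrakk> \<Longrightarrow> (\<Sum>g\<in>carrier G. z g * P g i j) = 0" for z w
  proof -
    let ?x = "\<Sum>g\<in>carrier G. s (z g) (\<pi> g w)"
    have "co ?x i = 0" if i: "i < d" for i
    proof -
      have "co ?x i = (\<Sum>g\<in>carrier G. z g * (\<Sum>j<d. P g i j * co w j))"
        using w piV by (simp add: co_lincomb_group co_pi)
      also have "\<dots> = (\<Sum>g\<in>carrier G. \<Sum>j<d. z g * P g i j * co w j)"
        by (simp add: sum_distrib_left mult.assoc)
      also have "\<dots> = (\<Sum>j<d. (\<Sum>g\<in>carrier G. z g * P g i j) * co w j)"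
        by (subst sum.swap) (simp add: sum_distrib_right)
      finally show ?thesis using z i by simp
    qed
    moreover have "?x \<in> V" using w piV subV by (auto intro!: subspace_sum subspace_scale)
    ultimately show ?thesis using expand[of ?x] by simp
  qed
  show thesis using that[of P] irrP chi zero by (simp add: d_def)
qed

end

lemma seq_vector_space: "vector_space seq_scale"
  by unfold_locales (auto simp: seq_scale_def fun_eq_iff algebra_simps)

lemma sum_fun_apply:
  fixes f :: "'i \<Rightarrow> 'x \<Rightarrow> complex"
  shows "(\<Sum>i\<in>I. f i) n = (\<Sum>i\<in>I. f i n)"
  by (induction I rule: infinite_finite_induct) auto

lemma seq_lincomb_unit:
  "(\<Sum>i<d. seq_scale (u i) (\<lambda>n. if n = i then 1 else 0)) = (\<lambda>n. if n < d then u n else 0)"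
proof
  fix n
  have "(\<Sum>i<d. seq_scale (u i) (\<lambda>n. if n = i then 1 else 0)) n = (\<Sum>i<d. if i = n then u n else 0)"
    unfolding sum_fun_apply by (intro sum.cong) (auto simp: seq_scale_def)
  then show "(\<Sum>i<d. seq_scale (u i) (\<lambda>n. if n = i then 1 else 0)) n = (if n < d then u n else 0)"
    by simp
qed

context unitary_twist
begin

lemma irr_mat_mult:
  "\<lbrakk>irr_mat d P; x \<in> carrier G; y \<in> carrier G; i < d; j < d\<rbrakk> \<Longrightarrow>
    (\<Sum>k<d. P x i k * P y k j) = \<alpha> x y * P (x \<otimes> y) i j"
  by (simp add: irr_mat_def)

lemma irr_mat_one:
  "\<lbrakk>irr_mat d P; i < d; j < d\<rbrakk> \<Longrightarrow> P \<one> i j = (if i = j then 1 else 0)"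
  by (simp add: irr_mat_def)

lemma irr_mat_cyclic:
  assumes "irr_mat d P" "i < d" "v i \<noteq> 0"
  obtains c where "\<And>i. i < d \<Longrightarrow> w i = (\<Sum>g\<in>carrier G. c g * (\<Sum>j<d. P g i j * v j))"
  using assms unfolding irr_mat_def by blast

text \<open>Letting the matrices act on the sequences that vanish from position \<open>d\<close> on realises any irreducible
character, whatever space it came from, inside the space of sequences.\<close>

lemma mat_char_in_irr_chars:
  assumes P: "irr_mat d P"
  shows "mat_char d P \<in> irr_chars G \<alpha>"
proof -
  interpret sq: vector_space seq_scale by (rule seq_vector_space)
  define V :: "(nat \<Rightarrow> complex) set" where "V = {f. \<forall>i\<ge>d. f i = 0}"
  define e :: "nat \<Rightarrow> nat \<Rightarrow> complex" where "e j = (\<lambda>n. if n = j then 1 else 0)" for j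
  define \<pi> :: "'a \<Rightarrow> (nat \<Rightarrow> complex) \<Rightarrow> nat \<Rightarrow> complex"
    where "\<pi> g f = (\<lambda>i. if i < d then \<Sum>j<d. P g i j * f j else 0)" for g f
  have inj: "inj_on e {..<d}" by (auto simp: inj_on_def e_def fun_eq_iff split: if_splits)
  have subV: "sq.subspace V"
    by (rule sq.subspaceI) (auto simp: V_def seq_scale_def)
  have exp_f: "f = (\<Sum>i<d. seq_scale (f i) (e i))" if "f \<in> V" for f
    unfolding e_def seq_lincomb_unit using that by (auto simp: V_def fun_eq_iff)
  have span: "sq.span (e ` {..<d}) = V"
  proof
    show "sq.span (e ` {..<d}) \<subseteq> V"
      by (rule sq.span_minimal[OF _ subV]) (auto simp: V_def e_def)
    show "V \<subseteq> sq.span (e ` {..<d})"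
    proof
      fix f assume "f \<in> V"
      have "(\<Sum>i<d. seq_scale (f i) (e i)) \<in> sq.span (e ` {..<d})"
        by (intro sq.span_sum sq.span_scale sq.span_base) auto
      then show "f \<in> sq.span (e ` {..<d})" using exp_f[OF \<open>f \<in> V\<close>] by simp
    qed
  qed
  have ind: "\<not> sq.dependent (e ` {..<d})"
  proof (rule sq.independent_if_scalars_zero)
    fix f x assume 0: "(\<Sum>x\<in>e ` {..<d}. seq_scale (f x) x) = 0" and "x \<in> e ` {..<d}"
    then obtain i where i: "i < d" "x = e i" by auto
    have "(\<Sum>x\<in>e ` {..<d}. seq_scale (f x) x) = (\<Sum>i<d. seq_scale (f (e i)) (e i))"
      by (simp add: sum.reindex[OF inj])
    also have "\<dots> = (\<lambda>n. if n < d then f (e n) else 0)"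
      unfolding e_def seq_lincomb_unit by simp
    finally have "(\<lambda>n. if n < d then f (e n) else 0) = 0" using 0 by simp
    then show "f x = 0" using i by (auto dest: fun_cong[of _ _ i])
  qed simp
  have endo: "endo_on seq_scale V (\<pi> g)" for g
    by (auto simp: endo_on_def V_def \<pi>_def seq_scale_def fun_eq_iff sum.distrib sum_distrib_left algebra_simps)
  have piV: "\<pi> g f \<in> V" for g f by (auto simp: V_def \<pi>_def)
  have mult: "\<pi> x (\<pi> y f) = seq_scale (\<alpha> x y) (\<pi> (x \<otimes> y) f)"
    if "x \<in> carrier G" "y \<in> carrier G" for x y f
  proof
    fix i
    have "(\<Sum>k<d. P x i k * (\<Sum>j<d. P y k j * f j)) = (\<Sum>j<d. \<alpha> x y * P (x \<otimes> y) i j * f j)" if "i < d"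
    proof -
      have "(\<Sum>k<d. P x i k * (\<Sum>j<d. P y k j * f j)) = (\<Sum>j<d. (\<Sum>k<d. P x i k * P y k j) * f j)"
        unfolding sum_distrib_left sum_distrib_right by (subst sum.swap) (simp add: mult.assoc)
      then show ?thesis
        using irr_mat_mult[OF P \<open>x \<in> carrier G\<close> \<open>y \<in> carrier G\<close> that] by simp
    qed
    then show "\<pi> x (\<pi> y f) i = seq_scale (\<alpha> x y) (\<pi> (x \<otimes> y) f) i"
      by (simp add: \<pi>_def seq_scale_def sum_distrib_left mult.assoc)
  qed
  have one: "\<pi> \<one> f = f" if "f \<in> V" for f
  proof
    fix i
    have "(\<Sum>j<d. P \<one> i j * f j) = (\<Sum>j<d. if j = i then f j else 0)" if "i < d"
      using that by (intro sum.cong) (auto simp: irr_mat_one[OF P])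
    then show "\<pi> \<one> f i = f i" using that by (auto simp: \<pi>_def V_def)
  qed
  have bij: "bij_betw (\<pi> g) V V" if g: "g \<in> carrier G" for g
  proof (rule bij_betw_byWitness[where f'="\<lambda>f. seq_scale (1 / \<alpha> g (inv g)) (\<pi> (inv g) f)"])
    have lin: "\<pi> g (seq_scale c f) = seq_scale c (\<pi> g f)" if "f \<in> V" for c f
      using endo that by (auto simp: endo_on_def)
    show "\<forall>f\<in>V. seq_scale (1 / \<alpha> g (inv g)) (\<pi> (inv g) (\<pi> g f)) = f"
      using g by (auto simp: mult one multiplier_inv_commute)
    show "\<forall>f\<in>V. \<pi> g (seq_scale (1 / \<alpha> g (inv g)) (\<pi> (inv g) f)) = f"
      using g piV by (auto simp: mult one lin)
    show "\<pi> g ` V \<subseteq> V" using piV by auto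
    show "(\<lambda>f. seq_scale (1 / \<alpha> g (inv g)) (\<pi> (inv g) f)) ` V \<subseteq> V"
      using piV subV by (auto intro: sq.subspace_scale)
  qed
  have nz: "V \<noteq> {0}"
  proof -
    have "0 < d" using P by (simp add: irr_mat_def)
    then have "e 0 \<in> V" "e 0 \<noteq> 0" by (auto simp: V_def e_def fun_eq_iff)
    then show ?thesis by auto
  qed
  have "proj_rep G \<alpha> seq_scale V \<pi>"
    unfolding proj_rep_def fin_dim_space_def general_linear_def
    using seq_vector_space subV span nz bij endo mult by (auto simp: endo_on_def intro!: exI[of _ "e ` {..<d}"])
  moreover have "W = {0} \<or> W = V"
    if W: "sq.subspace W" "W \<subseteq> V" "\<forall>g\<in>carrier G. \<pi> g ` W \<subseteq> W" for W
  proof (rule disjCI)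
    assume "W \<noteq> V"
    show "W = {0}"
    proof (rule ccontr)
      assume "W \<noteq> {0}"
      then obtain v where v: "v \<in> W" "v \<noteq> 0" using sq.subspace_0[OF W(1)] by blast
      then obtain i where "v i \<noteq> 0" by (auto simp: fun_eq_iff)
      have "i < d" using v W(2) \<open>v i \<noteq> 0\<close> by (force simp: V_def not_le[symmetric])
      have "w \<in> W" if w: "w \<in> V" for w
      proof -
        obtain c where c: "\<And>i. i < d \<Longrightarrow> w i = (\<Sum>g\<in>carrier G. c g * (\<Sum>j<d. P g i j * v j))"
          using irr_mat_cyclic[where w=w and v=v, OF P \<open>i < d\<close> \<open>v i \<noteq> 0\<close>] by blast
        have "w = (\<Sum>g\<in>carrier G. seq_scale (c g) (\<pi> g v))"
        proof
          fix i show "w i = (\<Sum>g\<in>carrier G. seq_scale (c g) (\<pi> g v)) i"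
            unfolding sum_fun_apply using w c[of i]
            by (cases "i < d") (auto simp: seq_scale_def \<pi>_def V_def)
        qed
        also have "\<dots> \<in> W" using W v by (auto intro!: sq.subspace_sum sq.subspace_scale)
        finally show ?thesis .
      qed
      then show False using W(2) \<open>W \<noteq> V\<close> by auto
    qed
  qed
  ultimately have irr: "irreducible_proj_rep G \<alpha> seq_scale V \<pi>"
    by (auto simp: irreducible_proj_rep_def)
  have "trace_on seq_scale V (\<pi> g) = (\<Sum>i<d. P g i i)" for g
  proof (rule trace_on_eq_coordinates[OF seq_vector_space inj ind span endo, where X="P g"])
    fix j assume "j < d"
    have "\<pi> g (e j) = (\<lambda>i. if i < d then P g i j else 0)"
      using \<open>j < d\<close> by (auto simp: \<pi>_def e_def fun_eq_iff if_distrib cong: if_cong)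
    then show "\<pi> g (e j) = (\<Sum>i<d. seq_scale (P g i j) (e i))"
      unfolding e_def seq_lincomb_unit by simp
  qed
  then have "mat_char d P = rep_char G seq_scale V \<pi>"
    by (simp add: mat_char_def rep_char_def)
  with irr show ?thesis by (auto simp: irr_chars_def)
qed

lemma irr_char_matrix_form:
  assumes "\<chi> \<in> irr_chars G \<alpha>"
  obtains d P where "irr_mat d P" "\<chi> = mat_char d P"
proof -
  obtain V \<pi> where irr: "irreducible_proj_rep G \<alpha> seq_scale V \<pi>" and chi: "\<chi> = rep_char G seq_scale V \<pi>"
    using assms by (auto simp: irr_chars_def)
  show ?thesis
    by (rule irreducible_proj_rep_matrix_form[OF irr]) (rule that, assumption, simp only: chi)
qed

end

section \<open>Schur's lemma and the orthogonality relations\<close>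

definition mmul :: "nat \<Rightarrow> (nat \<Rightarrow> nat \<Rightarrow> complex) \<Rightarrow> (nat \<Rightarrow> nat \<Rightarrow> complex) \<Rightarrow> nat \<Rightarrow> nat \<Rightarrow> complex" where
  "mmul n X Y = (\<lambda>i j. \<Sum>k<n. X i k * Y k j)"

lemma mmul_assoc: "mmul n (mmul m X Y) Z i j = mmul m X (mmul n Y Z) i j"
proof -
  have "(\<Sum>k<n. \<Sum>l<m. X i l * Y l k * Z k j) = (\<Sum>l<m. \<Sum>k<n. X i l * Y l k * Z k j)"
    by (rule sum.swap)
  then show ?thesis by (simp add: mmul_def sum_distrib_left sum_distrib_right mult.assoc)
qed

lemma mmul_assoc_fun: "mmul n (mmul m X Y) Z = mmul m X (mmul n Y Z)"
  by (intro ext mmul_assoc)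

lemma mmul_cong:
  "\<lbrakk>\<And>k. k < n \<Longrightarrow> X i k = X' i k; \<And>k. k < n \<Longrightarrow> Y k j = Y' k j\<rbrakk> \<Longrightarrow>
    mmul n X Y i j = mmul n X' Y' i j"
  by (simp add: mmul_def)

lemma mmul_id_right:
  assumes "j < n" "\<And>k. k < n \<Longrightarrow> Y k j = (if k = j then 1 else 0)"
  shows "mmul n X Y i j = X i j"
proof -
  have "mmul n X Y i j = (\<Sum>k<n. if k = j then X i k else 0)"
    unfolding mmul_def using assms by (intro sum.cong) auto
  then show ?thesis using assms by simp
qed

lemma mmul_id_left:
  assumes "i < n" "\<And>k. k < n \<Longrightarrow> X i k = (if i = k then 1 else 0)"
  shows "mmul n X Y i j = Y i j"
proof -
  have "mmul n X Y i j = (\<Sum>k<n. if k = i then Y k j else 0)"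
    unfolding mmul_def using assms by (intro sum.cong) auto
  then show ?thesis using assms by simp
qed

lemma trace_mmul_commute:
  "(\<Sum>i<n. mmul m X Y i i) = (\<Sum>j<m. mmul n Y X j j)"
  unfolding mmul_def by (subst sum.swap) (simp add: mult.commute)

text \<open>A row vector times a sum of rank-one matrices $x_g y_g^T$ times a column vector.\<close>

lemma sum_product_middle:
  fixes p q :: "nat \<Rightarrow> complex"
  shows "(\<Sum>a<m. p a * (\<Sum>b<n. (\<Sum>g\<in>S. x g a * y g b) * q b))
    = (\<Sum>g\<in>S. (\<Sum>a<m. p a * x g a) * (\<Sum>b<n. y g b * q b))"
proof -
  have "(\<Sum>a<m. p a * (\<Sum>b<n. (\<Sum>g\<in>S. x g a * y g b) * q b))
      = (\<Sum>a<m. \<Sum>b<n. \<Sum>g\<in>S. p a * x g a * (y g b * q b))"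
    by (simp add: sum_distrib_left sum_distrib_right mult.assoc)
  also have "\<dots> = (\<Sum>a<m. \<Sum>g\<in>S. \<Sum>b<n. p a * x g a * (y g b * q b))"
    by (intro sum.cong refl sum.swap)
  also have "\<dots> = (\<Sum>g\<in>S. \<Sum>a<m. \<Sum>b<n. p a * x g a * (y g b * q b))"
    by (rule sum.swap)
  finally show ?thesis by (simp add: sum_product)
qed

context unitary_twist
begin

lemma sum_shift_right:
  fixes f :: "'a \<Rightarrow> 'c::comm_monoid_add"
  assumes "h \<in> carrier G"
  shows "(\<Sum>g\<in>carrier G. f (g \<otimes> h)) = (\<Sum>g\<in>carrier G. f g)"
  by (rule sum.reindex_bij_witness[where i="\<lambda>g. g \<otimes> inv h" and j="\<lambda>g. g \<otimes> h"])
     (use assms in \<open>auto simp: m_assoc\<close>)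

text \<open>Used to move an operator past the expansion of a vector in the translates of a cyclic vector.\<close>

lemma mmul_group_comb:
  "(\<Sum>k<n. X i k * (\<Sum>g\<in>carrier G. c g * (\<Sum>j<m. P g k j * v j)))
    = (\<Sum>g\<in>carrier G. c g * (\<Sum>j<m. mmul n X (P g) i j * v j))"
proof -
  have "(\<Sum>k<n. X i k * (\<Sum>g\<in>carrier G. c g * (\<Sum>j<m. P g k j * v j)))
      = (\<Sum>g\<in>carrier G. \<Sum>k<n. c g * (X i k * (\<Sum>j<m. P g k j * v j)))"
    by (subst sum.swap) (simp add: sum_distrib_left mult_ac)
  also have "\<dots> = (\<Sum>g\<in>carrier G. c g * mmul n X (mmul m (P g) (\<lambda>j _. v j)) i 0)"
    by (simp add: mmul_def sum_distrib_left)
  also have "\<dots> = (\<Sum>g\<in>carrier G. c g * mmul m (mmul n X (P g)) (\<lambda>j _. v j) i 0)"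
    by (simp add: mmul_assoc)
  finally show ?thesis by (simp add: mmul_def)
qed

lemma irr_mat_mmul:
  "\<lbrakk>irr_mat d P; x \<in> carrier G; y \<in> carrier G; i < d; j < d\<rbrakk> \<Longrightarrow>
    mmul d (P x) (P y) i j = \<alpha> x y * P (x \<otimes> y) i j"
  by (simp add: irr_mat_mult mmul_def)

text \<open>Schur's lemma. An eigenvector of \<open>X\<close> is cyclic, and \<open>X\<close> commutes with the action, so \<open>X\<close> multiplies
every vector by the same eigenvalue.\<close>

lemma mat_commutant_scalar:
  assumes P: "irr_mat d P"
    and comm: "\<And>g i j. \<lbrakk>g \<in> carrier G; i < d; j < d\<rbrakk> \<Longrightarrow> mmul d (P g) X i j = mmul d X (P g) i j"
  obtains l where "\<And>i j. \<lbrakk>i < d; j < d\<rbrakk> \<Longrightarrow> X i j = (if i = j then l else 0)"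
proof -
  define A where "A = mat d d (\<lambda>(i, j). X i j)"
  have d: "0 < d" using P by (simp add: irr_mat_def)
  have A: "A \<in> carrier_mat d d" by (simp add: A_def)
  obtain l where "eigenvalue A l" using spectrum_non_empty[OF A d] by (auto simp: spectrum_def)
  then obtain u where u: "u \<in> carrier_vec d" "u \<noteq> 0\<^sub>v d" "A *\<^sub>v u = l \<cdot>\<^sub>v u"
    using A by (auto simp: eigenvalue_def eigenvector_def)
  obtain i0 where i0: "i0 < d" "u $ i0 \<noteq> 0" using u(1,2) by (auto simp: vec_eq_iff)
  have eig: "(\<Sum>j<d. X i j * u $ j) = l * u $ i" if i: "i < d" for i
  proof -
    have "(A *\<^sub>v u) $ i = l * u $ i" using u i by simp
    then show ?thesis using i u(1) by (simp add: A_def scalar_prod_def atLeast0LessThan)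
  qed
  have "X i j = (if i = j then l else 0)" if ij: "i < d" "j < d" for i j
  proof -
    define w :: "nat \<Rightarrow> complex" where "w k = (if k = j then 1 else 0)" for k
    obtain c where c: "\<And>i. i < d \<Longrightarrow> w i = (\<Sum>g\<in>carrier G. c g * (\<Sum>k<d. P g i k * u $ k))"
      by (rule irr_mat_cyclic[where w=w and v="\<lambda>k. u $ k", OF P i0]) blast
    have "X i j = (\<Sum>k<d. X i k * w k)" using ij by (simp add: w_def if_distrib cong: if_cong)
    also have "\<dots> = (\<Sum>k<d. X i k * (\<Sum>g\<in>carrier G. c g * (\<Sum>j<d. P g k j * u $ j)))"
      using c by simp
    also have "\<dots> = (\<Sum>g\<in>carrier G. c g * (\<Sum>j<d. mmul d X (P g) i j * u $ j))"
      by (rule mmul_group_comb)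
    also have "\<dots> = (\<Sum>g\<in>carrier G. c g * mmul d (mmul d (P g) X) (\<lambda>j _. u $ j) i 0)"
      using ij comm by (simp add: mmul_def)
    also have "\<dots> = (\<Sum>g\<in>carrier G. c g * (\<Sum>k<d. P g i k * (l * u $ k)))"
      unfolding mmul_assoc by (simp add: mmul_def eig)
    also have "\<dots> = l * w i" using c[OF ij(1)] by (simp add: sum_distrib_left mult_ac)
    finally show ?thesis by (simp add: w_def)
  qed
  then show thesis by (rule that)
qed

text \<open>Schur's lemma for two representations. A nonzero vector in the kernel of \<open>X\<close> would be cyclic and force
\<open>X = 0\<close>, and a nonzero column of \<open>X\<close> is cyclic and lies in the range; hence \<open>X\<close> is invertible and
conjugates one representation into the other.\<close>

lemma mat_char_eq_of_intertwiner:
  assumes P: "irr_mat d P" and P': "irr_mat d' P'"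
    and comm: "\<And>g i j. \<lbrakk>g \<in> carrier G; i < d; j < d'\<rbrakk> \<Longrightarrow> mmul d (P g) X i j = mmul d' X (P' g) i j"
    and ab: "a < d" "b < d'" "X a b \<noteq> 0"
  shows "mat_char d P = mat_char d' P'"
proof -
  have inj: "v l = 0" if v: "\<And>i. i < d \<Longrightarrow> (\<Sum>j<d'. X i j * v j) = 0" and l: "l < d'" for v l
  proof (rule ccontr)
    assume vl: "v l \<noteq> 0"
    define w :: "nat \<Rightarrow> complex" where "w k = (if k = b then 1 else 0)" for k
    obtain c where c: "\<And>i. i < d' \<Longrightarrow> w i = (\<Sum>g\<in>carrier G. c g * (\<Sum>k<d'. P' g i k * v k))"
      by (rule irr_mat_cyclic[where w=w and v=v, OF P' l vl]) blast
    have "X a b = (\<Sum>k<d'. X a k * w k)" using ab by (simp add: w_def if_distrib cong: if_cong)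
    also have "\<dots> = (\<Sum>k<d'. X a k * (\<Sum>g\<in>carrier G. c g * (\<Sum>j<d'. P' g k j * v j)))"
      using c by simp
    also have "\<dots> = (\<Sum>g\<in>carrier G. c g * (\<Sum>j<d'. mmul d' X (P' g) a j * v j))"
      by (rule mmul_group_comb)
    also have "\<dots> = (\<Sum>g\<in>carrier G. c g * mmul d' (mmul d (P g) X) (\<lambda>j _. v j) a 0)"
      using ab comm by (simp add: mmul_def)
    also have "\<dots> = 0" unfolding mmul_assoc by (simp add: mmul_def v)
    finally show False using ab by simp
  qed
  \<comment> \<open>a preimage under \<open>X\<close> of every unit vector: the columns of the inverse matrix\<close>
  have "\<exists>y. \<forall>i<d. (\<Sum>k<d'. X i k * y k) = (if i = m then 1 else 0)" for m
  proof -
    obtain c where c: "\<And>i. i < d \<Longrightarrow>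
        (if i = m then 1 else 0) = (\<Sum>g\<in>carrier G. c g * (\<Sum>j<d. P g i j * X j b))"
      by (rule irr_mat_cyclic[where w="\<lambda>i. if i = m then 1 else 0" and v="\<lambda>j. X j b", OF P ab(1,3)]) blast
    have "(\<Sum>k<d'. X i k * (\<Sum>g\<in>carrier G. c g * P' g k b)) = (if i = m then 1 else 0)" if i: "i < d" for i
    proof -
      have "(\<Sum>k<d'. X i k * (\<Sum>g\<in>carrier G. c g * P' g k b))
          = (\<Sum>k<d'. X i k * (\<Sum>g\<in>carrier G. c g * (\<Sum>j<d'. P' g k j * (if j = b then 1 else 0))))"
        using ab by (simp add: if_distrib cong: if_cong)
      also have "\<dots> = (\<Sum>g\<in>carrier G. c g * (\<Sum>j<d'. mmul d' X (P' g) i j * (if j = b then 1 else 0)))"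
        by (rule mmul_group_comb)
      also have "\<dots> = (\<Sum>g\<in>carrier G. c g * mmul d' X (P' g) i b)"
        using ab by (simp add: if_distrib cong: if_cong)
      also have "\<dots> = (\<Sum>g\<in>carrier G. c g * mmul d (P g) X i b)"
        using ab i comm by simp
      finally show ?thesis using c[OF i] by (simp add: mmul_def)
    qed
    then show ?thesis by (intro exI[where x="\<lambda>k. \<Sum>g\<in>carrier G. c g * P' g k b"]) blast
  qed
  then have "\<exists>Y. \<forall>m. \<forall>i<d. (\<Sum>k<d'. X i k * Y m k) = (if i = m then 1 else 0)"
    by (intro choice allI)
  then obtain Y0 where Y0: "\<And>m i. i < d \<Longrightarrow> (\<Sum>k<d'. X i k * Y0 m k) = (if i = m then 1 else 0)"
    by blast
  define Y where "Y k m = Y0 m k" for k m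
  have XY: "mmul d' X Y i m = (if i = m then 1 else 0)" if "i < d" for i m
    using Y0[OF that] by (simp add: mmul_def Y_def)
  have YX: "mmul d Y X l m = (if l = m then 1 else 0)" if lm: "l < d'" "m < d'" for l m
  proof -
    have "mmul d Y X l m - (if l = m then 1 else 0) = 0"
    proof (rule inj[where v="\<lambda>l. mmul d Y X l m - (if l = m then 1 else 0)", OF _ lm(1)])
      fix i assume i: "i < d"
      have "mmul d' X (mmul d Y X) i m = X i m"
        unfolding mmul_assoc[symmetric] by (rule mmul_id_left) (use i XY in auto)
      moreover have "mmul d' X (\<lambda>j m. if j = m then 1 else 0) i m = X i m"
        by (rule mmul_id_right) (use lm in auto)
      ultimately show "(\<Sum>j<d'. X i j * (mmul d Y X j m - (if j = m then 1 else 0))) = 0"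
        by (simp only: mmul_def[of d' X] right_diff_distrib sum_subtractf) simp
    qed
    then show ?thesis by simp
  qed
  have "(\<Sum>i<d. P g i i) = (\<Sum>l<d'. P' g l l)" if g: "g \<in> carrier G" for g
  proof -
    have "(\<Sum>i<d. P g i i) = (\<Sum>i<d. mmul d (P g) (mmul d' X Y) i i)"
      using XY by (intro sum.cong refl mmul_id_right[symmetric]) auto
    also have "\<dots> = (\<Sum>i<d. mmul d' (mmul d (P g) X) Y i i)" by (simp add: mmul_assoc)
    also have "\<dots> = (\<Sum>i<d. mmul d' (mmul d' X (P' g)) Y i i)"
      by (intro sum.cong refl mmul_cong) (use comm g in auto)
    also have "\<dots> = (\<Sum>l<d'. mmul d Y (mmul d' X (P' g)) l l)" by (rule trace_mmul_commute)
    also have "\<dots> = (\<Sum>l<d'. mmul d' (mmul d Y X) (P' g) l l)" by (simp add: mmul_assoc)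
    also have "\<dots> = (\<Sum>l<d'. P' g l l)"
      using YX by (intro sum.cong refl mmul_id_left) auto
    finally show ?thesis .
  qed
  then show ?thesis by (auto simp: mat_char_def)
qed

text \<open>This is $\sum_g P_g E_{jk} P_g'^*$ with the matrix unit $E_{jk}$. With the conjugate transpose in place of the
inverse the invariance below still holds, because $\alpha$ has modulus one.\<close>

definition average :: "('a \<Rightarrow> nat \<Rightarrow> nat \<Rightarrow> complex) \<Rightarrow> ('a \<Rightarrow> nat \<Rightarrow> nat \<Rightarrow> complex) \<Rightarrow> nat \<Rightarrow> nat \<Rightarrow>
    nat \<Rightarrow> nat \<Rightarrow> complex" where
  "average P P' j k = (\<lambda>i l. \<Sum>g\<in>carrier G. P g i j * cnj (P' g l k))"

definition inv_form :: "nat \<Rightarrow> ('a \<Rightarrow> nat \<Rightarrow> nat \<Rightarrow> complex) \<Rightarrow> nat \<Rightarrow> nat \<Rightarrow> complex" where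
  "inv_form d P = (\<lambda>a b. \<Sum>(g, m)\<in>carrier G \<times> {..<d}. cnj (P g m a) * P g m b)"

definition adj :: "(nat \<Rightarrow> nat \<Rightarrow> complex) \<Rightarrow> nat \<Rightarrow> nat \<Rightarrow> complex" where
  "adj X = (\<lambda>i j. cnj (X j i))"

lemma average_invariant:
  assumes P: "irr_mat d P" and P': "irr_mat d' P'" and h: "h \<in> carrier G"
    and idx: "i < d" "j < d" "l < d'" "k < d'"
  shows "mmul d (P h) (mmul d' (average P P' j k) (adj (P' h))) i l = average P P' j k i l"
proof -
  have "mmul d (P h) (mmul d' (average P P' j k) (adj (P' h))) i l
      = (\<Sum>g\<in>carrier G. (\<Sum>a<d. P h i a * P g a j) * (\<Sum>b<d'. cnj (P' g b k) * cnj (P' h l b)))"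
    unfolding mmul_def average_def adj_def by (rule sum_product_middle)
  also have "\<dots> = (\<Sum>g\<in>carrier G. mmul d (P h) (P g) i j * cnj (mmul d' (P' h) (P' g) l k))"
    by (simp add: mmul_def mult.commute)
  also have "\<dots> = (\<Sum>g\<in>carrier G. (\<alpha> h g * cnj (\<alpha> h g)) * (P (h \<otimes> g) i j * cnj (P' (h \<otimes> g) l k)))"
    using h idx by (intro sum.cong refl) (simp only: irr_mat_mmul[OF P] irr_mat_mmul[OF P'] complex_cnj_mult mult_ac)
  also have "\<dots> = (\<Sum>g\<in>carrier G. P (h \<otimes> g) i j * cnj (P' (h \<otimes> g) l k))"
    using h by simp
  also have "\<dots> = average P P' j k i l" unfolding average_def
    by (rule sum_shift[OF h, of "\<lambda>g. P g i j * cnj (P' g l k)"])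
  finally show ?thesis .
qed

lemma inv_form_invariant:
  assumes P: "irr_mat d P" and h: "h \<in> carrier G" and idx: "l < d" "k < d"
  shows "mmul d (adj (P h)) (mmul d (inv_form d P) (P h)) l k = inv_form d P l k"
proof -
  have "mmul d (adj (P h)) (mmul d (inv_form d P) (P h)) l k
      = (\<Sum>p\<in>carrier G \<times> {..<d}. (\<Sum>a<d. cnj (P h a l) * cnj (P (fst p) (snd p) a)) *
           (\<Sum>b<d. P (fst p) (snd p) b * P h b k))"
    unfolding mmul_def inv_form_def adj_def case_prod_beta by (rule sum_product_middle)
  also have "\<dots> = (\<Sum>(g, m)\<in>carrier G \<times> {..<d}. cnj (mmul d (P g) (P h) m l) * mmul d (P g) (P h) m k)"
    by (simp add: mmul_def mult.commute case_prod_beta)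
  also have "\<dots> = (\<Sum>g\<in>carrier G. \<Sum>m<d. cnj (mmul d (P g) (P h) m l) * mmul d (P g) (P h) m k)"
    by (simp add: sum.cartesian_product)
  also have "\<dots> = (\<Sum>g\<in>carrier G. \<Sum>m<d. (\<alpha> g h * cnj (\<alpha> g h)) * (cnj (P (g \<otimes> h) m l) * P (g \<otimes> h) m k))"
    using h idx by (intro sum.cong refl) (simp only: irr_mat_mmul[OF P] lessThan_iff complex_cnj_mult mult_ac)
  also have "\<dots> = (\<Sum>g\<in>carrier G. \<Sum>m<d. cnj (P (g \<otimes> h) m l) * P (g \<otimes> h) m k)"
    using h by simp
  also have "\<dots> = (\<Sum>g\<in>carrier G. \<Sum>m<d. cnj (P g m l) * P g m k)"
    by (rule sum_shift_right[OF h, of "\<lambda>g. \<Sum>m<d. cnj (P g m l) * P g m k"])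
  also have "\<dots> = inv_form d P l k" by (simp add: inv_form_def sum.cartesian_product)
  finally show ?thesis .
qed

text \<open>$P_h X H' = P_h X (P_h'^* H' P'_h) = (P_h X P_h'^*) H' P'_h = X H' P'_h$.\<close>

lemma average_intertwines:
  assumes P: "irr_mat d P" and P': "irr_mat d' P'" and jk: "j < d" "k < d'"
    and h: "h \<in> carrier G" and im: "i < d" "m < d'"
  shows "mmul d (P h) (mmul d' (average P P' j k) (inv_form d' P')) i m
    = mmul d' (mmul d' (average P P' j k) (inv_form d' P')) (P' h) i m"
proof -
  let ?X = "average P P' j k" and ?H = "inv_form d' P'"
  have "mmul d (P h) (mmul d' ?X ?H) i m
      = mmul d (P h) (mmul d' ?X (mmul d' (adj (P' h)) (mmul d' ?H (P' h)))) i m"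
    by (intro mmul_cong refl) (use inv_form_invariant[OF P' h] im in auto)
  also have "\<dots> = mmul d' (mmul d (P h) (mmul d' ?X (adj (P' h)))) (mmul d' ?H (P' h)) i m"
    by (simp only: mmul_assoc_fun)
  also have "\<dots> = mmul d' ?X (mmul d' ?H (P' h)) i m"
    by (intro mmul_cong refl) (use average_invariant[OF P P' h] im jk in auto)
  finally show ?thesis by (simp add: mmul_assoc)
qed

text \<open>The product is scalar by Schur's lemma. The scalar comes from the trace, to which each $g$ contributes
$(P_g^* H P_g)_{kj} = H_{kj}$.\<close>

lemma average_form_scalar:
  assumes P: "irr_mat d P" and jk: "j < d" "k < d" and im: "i < d" "m < d"
  shows "mmul d (average P P j k) (inv_form d P) i m
    = (if i = m then of_nat (card (carrier G)) * inv_form d P k j / of_nat d else 0)"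
proof -
  let ?X = "average P P j k" and ?H = "inv_form d P"
  have d: "0 < d" using P by (simp add: irr_mat_def)
  obtain l where l: "\<And>i m. \<lbrakk>i < d; m < d\<rbrakk> \<Longrightarrow> mmul d ?X ?H i m = (if i = m then l else 0)"
    by (rule mat_commutant_scalar[OF P average_intertwines[OF P P jk]]) blast+
  have "(\<Sum>i<d. mmul d ?X ?H i i) = of_nat d * l" using l by simp
  moreover have "(\<Sum>i<d. mmul d ?X ?H i i) = of_nat (card (carrier G)) * ?H k j"
  proof -
    have "(\<Sum>i<d. mmul d ?X ?H i i)
        = (\<Sum>i<d. \<Sum>l<d. \<Sum>g\<in>carrier G. cnj (P g l k) * (?H l i * P g i j))"
      unfolding mmul_def average_def sum_distrib_right by (intro sum.cong refl) (simp add: mult_ac)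
    also have "\<dots> = (\<Sum>i<d. \<Sum>g\<in>carrier G. \<Sum>l<d. cnj (P g l k) * (?H l i * P g i j))"
      by (intro sum.cong refl sum.swap)
    also have "\<dots> = (\<Sum>g\<in>carrier G. \<Sum>i<d. \<Sum>l<d. cnj (P g l k) * (?H l i * P g i j))"
      by (rule sum.swap)
    also have "\<dots> = (\<Sum>g\<in>carrier G. \<Sum>l<d. \<Sum>i<d. cnj (P g l k) * (?H l i * P g i j))"
      by (intro sum.cong refl sum.swap)
    also have "\<dots> = (\<Sum>g\<in>carrier G. mmul d (adj (P g)) (mmul d ?H (P g)) k j)"
      by (simp add: mmul_def adj_def sum_distrib_left)
    also have "\<dots> = (\<Sum>g\<in>carrier G. ?H k j)"
      using inv_form_invariant[OF P _ jk(2,1)] by simp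
    finally show ?thesis by simp
  qed
  ultimately show ?thesis using l[OF im] d by (simp add: field_simps)
qed

lemma inv_form_hermitian: "inv_form d P a b = cnj (inv_form d P b a)"
  by (simp add: inv_form_def case_prod_beta mult.commute)

lemma inv_form_nonzero:
  assumes P: "irr_mat d P" shows "inv_form d P 0 0 \<noteq> 0"
proof -
  have d: "0 < d" using P by (simp add: irr_mat_def)
  have eq: "inv_form d P 0 0 = complex_of_real (\<Sum>(g, m)\<in>carrier G \<times> {..<d}. (norm (P g m 0))\<^sup>2)"
    by (simp add: inv_form_def complex_norm_square case_prod_beta mult.commute del: of_real_power)
  have "(norm (P (fst (\<one>, 0 :: nat)) (snd (\<one>, 0 :: nat)) 0))\<^sup>2
      \<le> (\<Sum>p\<in>carrier G \<times> {..<d}. (norm (P (fst p) (snd p) 0))\<^sup>2)"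
    by (rule member_le_sum) (use finite_group d in auto)
  then have "1 \<le> (\<Sum>(g, m)\<in>carrier G \<times> {..<d}. (norm (P g m 0))\<^sup>2)"
    using irr_mat_one[OF P d d] by (simp add: case_prod_beta)
  then show ?thesis unfolding eq of_real_eq_0_iff by linarith
qed

text \<open>Up to the nonzero factor $H_{00}$, \<open>average_form_scalar\<close> with $j = k = 0$ exhibits a left inverse of $H$. As $H$
is Hermitian, the conjugate transpose of a left inverse is a right inverse.\<close>

lemma inv_form_inverse:
  assumes P: "irr_mat d P"
  obtains J where "\<And>i j. \<lbrakk>i < d; j < d\<rbrakk> \<Longrightarrow> mmul d (inv_form d P) J i j = (if i = j then 1 else 0)"
proof -
  let ?H = "inv_form d P"
  have d: "0 < d" using P by (simp add: irr_mat_def)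
  have n: "card (carrier G) \<noteq> 0" using finite_group by auto
  define c where "c = of_nat d / (of_nat (card (carrier G)) * ?H 0 0)"
  have "mmul d ?H (adj (\<lambda>i l. c * average P P 0 0 i l)) i j = (if i = j then 1 else 0)"
    if ij: "i < d" "j < d" for i j
  proof -
    have "mmul d ?H (adj (\<lambda>i l. c * average P P 0 0 i l)) i j
        = cnj (c * mmul d (average P P 0 0) ?H j i)"
      using inv_form_hermitian[of d P i] by (simp add: mmul_def adj_def sum_distrib_left mult_ac)
    also have "\<dots> = (if i = j then 1 else 0)"
      using average_form_scalar[OF P d d ij(2,1)] inv_form_nonzero[OF P] n d by (auto simp: c_def)
    finally show ?thesis .
  qed
  then show thesis by (rule that)
qed

lemma mat_char_inner_average:
  "(\<Sum>g\<in>carrier G. mat_char d P g * cnj (mat_char d' P' g)) = (\<Sum>i<d. \<Sum>l<d'. average P P' i l i l)"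
proof -
  have "(\<Sum>g\<in>carrier G. mat_char d P g * cnj (mat_char d' P' g))
      = (\<Sum>g\<in>carrier G. \<Sum>i<d. \<Sum>l<d'. P g i i * cnj (P' g l l))"
    by (simp add: mat_char_def sum_product)
  also have "\<dots> = (\<Sum>i<d. \<Sum>g\<in>carrier G. \<Sum>l<d'. P g i i * cnj (P' g l l))" by (rule sum.swap)
  also have "\<dots> = (\<Sum>i<d. \<Sum>l<d'. \<Sum>g\<in>carrier G. P g i i * cnj (P' g l l))"
    by (intro sum.cong refl sum.swap)
  finally show ?thesis by (simp add: average_def)
qed

text \<open>Cancelling $H$ gives $\sum_g P_g(i,j) \overline{P_g(l,k)} = \frac{|G|}{d} H_{kj} (H^{-1})_{il}$. Setting $j = i$, $k = l$
and summing leaves the trace of $H H^{-1}$.\<close>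

lemma mat_char_norm:
  assumes P: "irr_mat d P"
  shows "(\<Sum>g\<in>carrier G. mat_char d P g * cnj (mat_char d P g)) = of_nat (card (carrier G))"
proof -
  let ?H = "inv_form d P"
  have d: "0 < d" using P by (simp add: irr_mat_def)
  obtain J where J: "\<And>i j. \<lbrakk>i < d; j < d\<rbrakk> \<Longrightarrow> mmul d ?H J i j = (if i = j then 1 else 0)"
    using inv_form_inverse[OF P] by blast
  define c :: complex where "c = of_nat (card (carrier G)) / of_nat d"
  have "average P P j k i l = c * ?H k j * J i l" if "i < d" "l < d" "j < d" "k < d" for i l j k
  proof -
    have "average P P j k i l = mmul d (average P P j k) (mmul d ?H J) i l"
      by (rule mmul_id_right[symmetric]) (use J that in auto)
    also have "\<dots> = mmul d (mmul d (average P P j k) ?H) J i l" by (simp add: mmul_assoc)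
    also have "\<dots> = (\<Sum>m<d. if m = i then c * ?H k j * J m l else 0)"
      unfolding mmul_def[of d _ J] using that
      by (intro sum.cong refl) (simp add: average_form_scalar[OF P] c_def)
    finally show ?thesis using that by simp
  qed
  then have "(\<Sum>i<d. \<Sum>l<d. average P P i l i l) = (\<Sum>i<d. \<Sum>l<d. c * ?H l i * J i l)" by simp
  also have "\<dots> = c * (\<Sum>l<d. mmul d ?H J l l)"
    by (subst sum.swap) (simp add: mmul_def sum_distrib_left mult.assoc)
  also have "\<dots> = of_nat (card (carrier G))" using J d by (simp add: c_def)
  finally show ?thesis unfolding mat_char_inner_average .
qed

lemma mat_char_orthogonal:
  assumes P: "irr_mat d P" and P': "irr_mat d' P'" and ne: "mat_char d P \<noteq> mat_char d' P'"
  shows "(\<Sum>g\<in>carrier G. mat_char d P g * cnj (mat_char d' P' g)) = 0"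
proof -
  let ?H = "inv_form d' P'"
  obtain J where J: "\<And>i j. \<lbrakk>i < d'; j < d'\<rbrakk> \<Longrightarrow> mmul d' ?H J i j = (if i = j then 1 else 0)"
    using inv_form_inverse[OF P'] by blast
  have "average P P' j k i l = 0" if jk: "j < d" "k < d'" and il: "i < d" "l < d'" for j k i l
  proof -
    have 0: "mmul d' (average P P' j k) ?H a b = 0" if "a < d" "b < d'" for a b
      using mat_char_eq_of_intertwiner[OF P P' average_intertwines[OF P P' jk] that] ne by blast
    have "average P P' j k i l = mmul d' (average P P' j k) (mmul d' ?H J) i l"
      by (rule mmul_id_right[symmetric]) (use J il in auto)
    also have "\<dots> = mmul d' (mmul d' (average P P' j k) ?H) J i l" by (simp add: mmul_assoc)
    also have "\<dots> = 0" unfolding mmul_def[of d' _ J] using 0 il by simp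
    finally show ?thesis .
  qed
  then show ?thesis unfolding mat_char_inner_average by simp
qed

text \<open>Take traces in $e_{hgh^{-1}} = \beta_h(g)\, e_h e_g e_h^{-1}$.\<close>

lemma mat_char_conj:
  assumes P: "irr_mat d P" and g: "g \<in> carrier G" and h: "h \<in> carrier G"
  shows "mat_char d P (h \<otimes> g \<otimes> inv h) = \<beta> h g * mat_char d P g"
proof -
  let ?k = "inv h"
  have k: "?k \<in> carrier G" using h by simp
  have "\<alpha> g ?k * \<alpha> h (g \<otimes> ?k) * (\<Sum>i<d. P (h \<otimes> g \<otimes> ?k) i i)
      = \<alpha> g ?k * (\<Sum>i<d. mmul d (P h) (P (g \<otimes> ?k)) i i)"
    using g h k by (simp add: irr_mat_mmul[OF P] m_assoc sum_distrib_left mult.assoc)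
  also have "\<dots> = (\<Sum>i<d. mmul d (P h) (mmul d (P g) (P ?k)) i i)"
    unfolding mmul_def[of d "P h"] using g k
    by (simp add: irr_mat_mmul[OF P] sum_distrib_left mult_ac)
  also have "\<dots> = (\<Sum>i<d. mmul d (mmul d (P g) (P ?k)) (P h) i i)" by (rule trace_mmul_commute)
  also have "\<dots> = (\<Sum>i<d. mmul d (P g) (mmul d (P ?k) (P h)) i i)" by (simp add: mmul_assoc)
  also have "\<dots> = (\<Sum>i<d. \<alpha> h ?k * mmul d (P g) (P \<one>) i i)"
    unfolding mmul_def[of d "P g"] using h k
    by (simp add: irr_mat_mmul[OF P] multiplier_inv_commute sum_distrib_left mult_ac)
  also have "\<dots> = \<alpha> h ?k * (\<Sum>i<d. P g i i)"
    using g by (simp add: irr_mat_mmul[OF P] sum_distrib_left)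
  finally have "\<alpha> g ?k * \<alpha> h (g \<otimes> ?k) * mat_char d P (h \<otimes> g \<otimes> ?k) = \<alpha> h ?k * mat_char d P g"
    using g h by (simp add: mat_char_def)
  then show ?thesis using g h by (simp add: beta_conj_def field_simps)
qed

lemma mat_char_nonregular:
  assumes P: "irr_mat d P" and g: "g \<in> carrier G" and nr: "\<not> regular_elem G \<alpha> g"
  shows "mat_char d P g = 0"
proof -
  obtain h where h: "h \<in> carrier G" "g \<otimes> h = h \<otimes> g" "\<beta> h g \<noteq> 1"
    using g nr by (auto simp: regular_elem_def)
  have "h \<otimes> g \<otimes> inv h = g" using h g by (simp add: h(2)[symmetric] m_assoc)
  then have "mat_char d P g = \<beta> h g * mat_char d P g" using mat_char_conj[OF P g h(1)] by simp
  then show ?thesis using h(3) by simp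
qed

end

section \<open>Completeness of the irreducible characters\<close>

text \<open>The ambient space may have infinite dimension; the finite set \<open>S\<close> supplies the finite-dimensional space in
which dimensions can be compared.\<close>

lemma (in vector_space) subspace_eq_of_dim_le:
  assumes S: "finite S" and U: "subspace U" and UW: "U \<subseteq> W" and WS: "W \<subseteq> span S"
    and dim: "dim W \<le> dim U"
  shows "U = W"
proof -
  obtain B where B: "B \<subseteq> U" "independent B" "U \<subseteq> span B" "card B = dim U"
    using basis_exists[of U] by blast
  have "B \<subseteq> W" using B(1) UW by blast
  from maximal_independent_subset_extend[OF this B(2)]
  obtain C where C: "B \<subseteq> C" "C \<subseteq> W" "independent C" "W \<subseteq> span C" by blast
  have finC: "finite C" using independent_span_bound[OF S C(3)] C(2) WS by blast
  have "card C = dim W" using basis_card_eq_dim[OF C(2,4,3)] .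
  then have "B = C" using card_seteq[OF finC C(1)] dim B(4) by simp
  then have "W \<subseteq> U" using C(4) span_minimal[OF B(1) U] by blast
  with UW show ?thesis by blast
qed

lemma (in vector_space) minimal_subspace:
  assumes S: "finite S" and Q: "Q W0" and sub: "\<And>W. Q W \<Longrightarrow> subspace W \<and> W \<subseteq> span S"
  obtains W where "Q W" "\<And>U. \<lbrakk>Q U; U \<subseteq> W\<rbrakk> \<Longrightarrow> U = W"
proof -
  obtain W where W: "Q W" "\<And>U. Q U \<Longrightarrow> dim W \<le> dim U"
    using ex_has_least_nat[of Q W0 dim] Q by blast
  have "U = W" if "Q U" "U \<subseteq> W" for U
    by (rule subspace_eq_of_dim_le[OF S]) (use sub W that in auto)
  with W(1) show thesis by (rule that)
qed

definition fun_scale :: "complex \<Rightarrow> ('x \<Rightarrow> complex) \<Rightarrow> 'x \<Rightarrow> complex" where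
  "fun_scale c f = (\<lambda>x. c * f x)"

lemma fun_vector_space: "vector_space fun_scale"
  by unfold_locales (auto simp: fun_scale_def fun_eq_iff algebra_simps)

context unitary_twist
begin

text \<open>The transformation law of characters. Their conjugates are the coefficients of the central elements of the
twisted group algebra.\<close>

definition twisted_class_fun :: "('a \<Rightarrow> complex) \<Rightarrow> bool" where
  "twisted_class_fun f \<longleftrightarrow> (\<forall>g\<in>carrier G. \<forall>h\<in>carrier G. f (h \<otimes> g \<otimes> inv h) = \<beta> h g * f g)"

text \<open>The element $\sum_g \overline{f(g)} e_g$ commutes with $e_h$. Here \<open>Q\<close> is an arbitrary coordinate of the module on
which the algebra acts, so that the lemma serves both matrices and the regular representation.\<close>

lemma twisted_sum_commute:
  fixes Q :: "'a \<Rightarrow> complex"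
  assumes f: "twisted_class_fun f" and h: "h \<in> carrier G"
  shows "(\<Sum>g\<in>carrier G. cnj (f g) * (\<alpha> h g * Q (h \<otimes> g)))
    = (\<Sum>g\<in>carrier G. cnj (f g) * (\<alpha> g h * Q (g \<otimes> h)))"
proof -
  have "(\<Sum>g\<in>carrier G. cnj (f g) * (\<alpha> g h * Q (g \<otimes> h)))
      = (\<Sum>g\<in>carrier G. cnj (f (h \<otimes> g \<otimes> inv h)) * (\<alpha> (h \<otimes> g \<otimes> inv h) h * Q (h \<otimes> g)))"
    by (rule sum.reindex_bij_witness[where i="\<lambda>g. h \<otimes> g \<otimes> inv h" and j="\<lambda>g. inv h \<otimes> g \<otimes> h"])
       (use h in \<open>auto simp: m_assoc\<close>)
  also have "\<dots> = (\<Sum>g\<in>carrier G. cnj (f g) * (\<alpha> h g * Q (h \<otimes> g)))"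
  proof (intro sum.cong refl)
    fix g assume g: "g \<in> carrier G"
    have "\<beta> h g * cnj (\<beta> h g) = 1"
      using norm_beta[OF g h] by (simp add: complex_norm_square[symmetric])
    moreover have "f (h \<otimes> g \<otimes> inv h) = \<beta> h g * f g"
      using f g h by (simp add: twisted_class_fun_def)
    ultimately show "cnj (f (h \<otimes> g \<otimes> inv h)) * (\<alpha> (h \<otimes> g \<otimes> inv h) h * Q (h \<otimes> g))
        = cnj (f g) * (\<alpha> h g * Q (h \<otimes> g))"
      unfolding beta_times_multiplier[OF g h, symmetric] by (simp add: mult_ac)
  qed
  finally show ?thesis by simp
qed

definition supported :: "('a \<Rightarrow> complex) set" where
  "supported = {\<phi>. \<forall>x. x \<notin> carrier G \<longrightarrow> \<phi> x = 0}"

text \<open>The left regular representation $e_h$ and its adjoint, which is also its inverse as $\alpha$ has modulus one.\<close>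

definition lreg :: "'a \<Rightarrow> ('a \<Rightarrow> complex) \<Rightarrow> 'a \<Rightarrow> complex" where
  "lreg h \<phi> = (\<lambda>x. if x \<in> carrier G then \<alpha> h (inv h \<otimes> x) * \<phi> (inv h \<otimes> x) else 0)"

definition lreg_adj :: "'a \<Rightarrow> ('a \<Rightarrow> complex) \<Rightarrow> 'a \<Rightarrow> complex" where
  "lreg_adj h \<phi> = (\<lambda>x. if x \<in> carrier G then cnj (\<alpha> h x) * \<phi> (h \<otimes> x) else 0)"

definition inner_G :: "('a \<Rightarrow> complex) \<Rightarrow> ('a \<Rightarrow> complex) \<Rightarrow> complex" where
  "inner_G \<phi> \<psi> = (\<Sum>x\<in>carrier G. \<phi> x * cnj (\<psi> x))"

definition lmult :: "('a \<Rightarrow> complex) \<Rightarrow> ('a \<Rightarrow> complex) \<Rightarrow> 'a \<Rightarrow> complex" where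
  "lmult z \<phi> = (\<lambda>x. \<Sum>g\<in>carrier G. z g * lreg g \<phi> x)"

definition lmult_adj :: "('a \<Rightarrow> complex) \<Rightarrow> ('a \<Rightarrow> complex) \<Rightarrow> 'a \<Rightarrow> complex" where
  "lmult_adj z \<phi> = (\<lambda>x. \<Sum>g\<in>carrier G. cnj (z g) * lreg_adj g \<phi> x)"

lemma supported_lreg [simp]: "lreg h \<phi> \<in> supported" "lreg_adj h \<phi> \<in> supported"
  "lmult z \<phi> \<in> supported" "lmult_adj z \<phi> \<in> supported"
  by (simp_all add: supported_def lreg_def lreg_adj_def lmult_def lmult_adj_def)

lemma lreg_mult:
  assumes "x \<in> carrier G" "y \<in> carrier G"
  shows "lreg x (lreg y \<phi>) = fun_scale (\<alpha> x y) (lreg (x \<otimes> y) \<phi>)"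
proof
  fix u
  show "lreg x (lreg y \<phi>) u = fun_scale (\<alpha> x y) (lreg (x \<otimes> y) \<phi>) u"
  proof (cases "u \<in> carrier G")
    case True
    define w where "w = inv y \<otimes> (inv x \<otimes> u)"
    have w: "w \<in> carrier G" "y \<otimes> w = inv x \<otimes> u" "inv (x \<otimes> y) \<otimes> u = w"
      using assms True by (simp_all add: w_def inv_mult_group m_assoc)
    have "\<alpha> x (y \<otimes> w) * \<alpha> y w = \<alpha> x y * \<alpha> (x \<otimes> y) w" using cocycle[of x y w] assms w by simp
    then show ?thesis
      using True assms w by (simp add: lreg_def fun_scale_def w_def[symmetric] mult.assoc[symmetric])
  qed (simp add: lreg_def fun_scale_def)
qed

lemma lreg_one: "\<phi> \<in> supported \<Longrightarrow> lreg \<one> \<phi> = \<phi>"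
  by (auto simp: lreg_def supported_def fun_eq_iff)

lemma lreg_adj_inverse:
  assumes "h \<in> carrier G" "\<phi> \<in> supported"
  shows "lreg_adj h (lreg h \<phi>) = \<phi>" "lreg h (lreg_adj h \<phi>) = \<phi>"
  using assms by (auto simp: lreg_def lreg_adj_def supported_def fun_eq_iff mult.assoc[symmetric])

lemma lreg_lmult:
  assumes f: "twisted_class_fun f" and h: "h \<in> carrier G"
  shows "lreg h (lmult (\<lambda>g. cnj (f g)) \<phi>) = lmult (\<lambda>g. cnj (f g)) (lreg h \<phi>)"
proof
  fix x
  have "lreg h (lmult (\<lambda>g. cnj (f g)) \<phi>) x = (\<Sum>g\<in>carrier G. cnj (f g) * lreg h (lreg g \<phi>) x)"
    by (simp add: lreg_def[of h] lmult_def sum_distrib_left mult_ac)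
  also have "\<dots> = (\<Sum>g\<in>carrier G. cnj (f g) * (\<alpha> h g * lreg (h \<otimes> g) \<phi> x))"
    using h by (simp add: lreg_mult fun_scale_def)
  also have "\<dots> = (\<Sum>g\<in>carrier G. cnj (f g) * (\<alpha> g h * lreg (g \<otimes> h) \<phi> x))"
    by (rule twisted_sum_commute[OF f h])
  also have "\<dots> = lmult (\<lambda>g. cnj (f g)) (lreg h \<phi>) x"
    using h by (simp add: lreg_mult fun_scale_def lmult_def)
  finally show "lreg h (lmult (\<lambda>g. cnj (f g)) \<phi>) x = lmult (\<lambda>g. cnj (f g)) (lreg h \<phi>) x" .
qed

text \<open>An operator that commutes with $e_h$ commutes with $e_h^{-1} = e_h^*$.\<close>

lemma lreg_adj_lmult:
  assumes f: "twisted_class_fun f" and h: "h \<in> carrier G" and \<phi>: "\<phi> \<in> supported"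
  shows "lreg_adj h (lmult (\<lambda>g. cnj (f g)) \<phi>) = lmult (\<lambda>g. cnj (f g)) (lreg_adj h \<phi>)"
proof -
  have "lmult (\<lambda>g. cnj (f g)) (lreg_adj h \<phi>)
      = lreg_adj h (lreg h (lmult (\<lambda>g. cnj (f g)) (lreg_adj h \<phi>)))"
    using lreg_adj_inverse h by simp
  also have "\<dots> = lreg_adj h (lmult (\<lambda>g. cnj (f g)) \<phi>)"
    using lreg_adj_inverse h \<phi> by (simp add: lreg_lmult[OF f h])
  finally show ?thesis by simp
qed

lemma lmult_sum:
  "lmult z (\<lambda>x. \<Sum>g\<in>I. c g * F g x) x = (\<Sum>g\<in>I. c g * lmult z (F g) x)"
proof -
  have "lreg h (\<lambda>x. \<Sum>g\<in>I. c g * F g x) x = (\<Sum>g\<in>I. c g * lreg h (F g) x)" for h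
    by (simp add: lreg_def sum_distrib_left mult_ac)
  then have "lmult z (\<lambda>x. \<Sum>g\<in>I. c g * F g x) x = (\<Sum>h\<in>carrier G. \<Sum>g\<in>I. c g * (z h * lreg h (F g) x))"
    by (simp add: lmult_def sum_distrib_left mult_ac)
  also have "\<dots> = (\<Sum>g\<in>I. \<Sum>h\<in>carrier G. c g * (z h * lreg h (F g) x))" by (rule sum.swap)
  finally show ?thesis by (simp add: lmult_def sum_distrib_left)
qed

lemma lmult_normal:
  assumes f: "twisted_class_fun f" and \<phi>: "\<phi> \<in> supported"
  shows "lmult (\<lambda>g. cnj (f g)) (lmult_adj (\<lambda>g. cnj (f g)) \<phi>)
    = lmult_adj (\<lambda>g. cnj (f g)) (lmult (\<lambda>g. cnj (f g)) \<phi>)"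
proof
  fix x
  have "lmult (\<lambda>g. cnj (f g)) (lmult_adj (\<lambda>g. cnj (f g)) \<phi>) x
      = (\<Sum>h\<in>carrier G. f h * lmult (\<lambda>g. cnj (f g)) (lreg_adj h \<phi>) x)"
    unfolding lmult_adj_def lmult_sum by simp
  also have "\<dots> = (\<Sum>h\<in>carrier G. f h * lreg_adj h (lmult (\<lambda>g. cnj (f g)) \<phi>) x)"
    using lreg_adj_lmult[OF f _ \<phi>] by simp
  finally show "lmult (\<lambda>g. cnj (f g)) (lmult_adj (\<lambda>g. cnj (f g)) \<phi>) x
      = lmult_adj (\<lambda>g. cnj (f g)) (lmult (\<lambda>g. cnj (f g)) \<phi>) x"
    by (simp add: lmult_adj_def)
qed

lemma inner_lreg_adj:
  assumes h: "h \<in> carrier G" shows "inner_G (lreg h \<phi>) \<psi> = inner_G \<phi> (lreg_adj h \<psi>)"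
proof -
  have "inner_G (lreg h \<phi>) \<psi> = (\<Sum>x\<in>carrier G. lreg h \<phi> (h \<otimes> x) * cnj (\<psi> (h \<otimes> x)))"
    unfolding inner_G_def by (rule sum_shift[OF h, symmetric])
  also have "\<dots> = inner_G \<phi> (lreg_adj h \<psi>)"
    unfolding inner_G_def using h by (intro sum.cong refl) (simp add: lreg_def lreg_adj_def mult_ac)
  finally show ?thesis .
qed

lemma inner_lmult_adj: "inner_G (lmult z \<phi>) \<psi> = inner_G \<phi> (lmult_adj z \<psi>)"
proof -
  have "inner_G (lmult z \<phi>) \<psi> = (\<Sum>x\<in>carrier G. \<Sum>g\<in>carrier G. z g * (lreg g \<phi> x * cnj (\<psi> x)))"
    by (simp add: inner_G_def lmult_def sum_distrib_right mult.assoc)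
  also have "\<dots> = (\<Sum>g\<in>carrier G. z g * inner_G (lreg g \<phi>) \<psi>)"
    by (subst sum.swap) (simp add: inner_G_def sum_distrib_left)
  also have "\<dots> = (\<Sum>g\<in>carrier G. \<Sum>x\<in>carrier G. \<phi> x * (z g * cnj (lreg_adj g \<psi> x)))"
    by (simp add: inner_lreg_adj) (simp add: inner_G_def sum_distrib_left mult_ac)
  also have "\<dots> = (\<Sum>x\<in>carrier G. \<Sum>g\<in>carrier G. \<phi> x * (z g * cnj (lreg_adj g \<psi> x)))"
    by (rule sum.swap)
  finally show ?thesis by (simp add: inner_G_def lmult_adj_def sum_distrib_left)
qed

lemma inner_G_self_zero:
  assumes "\<phi> \<in> supported" "inner_G \<phi> \<phi> = 0" shows "\<phi> = 0"
proof
  fix x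
  have eq: "inner_G \<phi> \<phi> = complex_of_real (\<Sum>x\<in>carrier G. (norm (\<phi> x))\<^sup>2)"
    by (simp add: inner_G_def complex_norm_square del: of_real_power)
  have "(\<Sum>x\<in>carrier G. (norm (\<phi> x))\<^sup>2) = 0" using assms(2) unfolding eq of_real_eq_0_iff .
  then have "\<forall>x\<in>carrier G. (norm (\<phi> x))\<^sup>2 = 0"
    using finite_group by (subst (asm) sum_nonneg_eq_0_iff) auto
  then show "\<phi> x = 0 x" using assms(1) by (cases "x \<in> carrier G") (auto simp: supported_def)
qed

text \<open>A central element acts on an irreducible module as a scalar, which the trace determines.\<close>

lemma central_sum_scalar:
  assumes P: "irr_mat d P" and f: "twisted_class_fun f" and ij: "i < d" "j < d"
  shows "(\<Sum>g\<in>carrier G. cnj (f g) * P g i j)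
    = (if i = j then (\<Sum>g\<in>carrier G. mat_char d P g * cnj (f g)) / of_nat d else 0)"
proof -
  have d: "0 < d" using P by (simp add: irr_mat_def)
  define Z where "Z i j = (\<Sum>g\<in>carrier G. cnj (f g) * P g i j)" for i j
  have comm: "mmul d (P h) Z i j = mmul d Z (P h) i j"
    if h: "h \<in> carrier G" and ij: "i < d" "j < d" for h i j
  proof -
    have "mmul d (P h) Z i j = (\<Sum>g\<in>carrier G. cnj (f g) * mmul d (P h) (P g) i j)"
      unfolding mmul_def Z_def sum_distrib_left by (subst sum.swap) (simp add: mult_ac)
    also have "\<dots> = (\<Sum>g\<in>carrier G. cnj (f g) * (\<alpha> h g * P (h \<otimes> g) i j))"
      using h ij by (simp add: irr_mat_mmul[OF P])
    also have "\<dots> = (\<Sum>g\<in>carrier G. cnj (f g) * (\<alpha> g h * P (g \<otimes> h) i j))"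
      by (rule twisted_sum_commute[OF f h])
    also have "\<dots> = (\<Sum>g\<in>carrier G. cnj (f g) * mmul d (P g) (P h) i j)"
      using h ij by (simp add: irr_mat_mmul[OF P])
    also have "\<dots> = mmul d Z (P h) i j"
      unfolding mmul_def Z_def sum_distrib_right sum_distrib_left
      by (subst sum.swap) (simp add: mult_ac)
    finally show ?thesis .
  qed
  obtain l where l: "\<And>i j. \<lbrakk>i < d; j < d\<rbrakk> \<Longrightarrow> Z i j = (if i = j then l else 0)"
    by (rule mat_commutant_scalar[OF P comm]) blast+
  have "of_nat d * l = (\<Sum>i<d. Z i i)" using l by simp
  also have "\<dots> = (\<Sum>g\<in>carrier G. mat_char d P g * cnj (f g))"
    unfolding Z_def by (subst sum.swap) (simp add: mat_char_def sum_distrib_left mult.commute)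
  finally have "l = (\<Sum>g\<in>carrier G. mat_char d P g * cnj (f g)) / of_nat d"
    using d by (simp add: field_simps)
  then show ?thesis using l[OF ij] by (simp add: Z_def)
qed

lemma central_acts_zero_on_irreducible:
  assumes irr: "irreducible_proj_rep G \<alpha> s W \<pi>" and f: "twisted_class_fun f"
    and orth: "\<And>\<chi>. \<chi> \<in> irr_chars G \<alpha> \<Longrightarrow> (\<Sum>g\<in>carrier G. \<chi> g * cnj (f g)) = 0"
    and w: "w \<in> W"
  shows "(\<Sum>g\<in>carrier G. s (cnj (f g)) (\<pi> g w)) = 0"
proof (rule irreducible_proj_rep_matrix_form[OF irr])
  fix P
  let ?d = "vector_space.dim s W"
  assume P: "irr_mat ?d P"
    and zero: "\<And>z w. \<lbrakk>w \<in> W; \<And>i j. \<lbrakk>i < ?d; j < ?d\<rbrakk> \<Longrightarrow> (\<Sum>g\<in>carrier G. z g * P g i j) = 0\<rbrakk> \<Longrightarrow>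
      (\<Sum>g\<in>carrier G. s (z g) (\<pi> g w)) = 0"
  have "(\<Sum>g\<in>carrier G. cnj (f g) * P g i j) = 0" if "i < ?d" "j < ?d" for i j
    using central_sum_scalar[OF P f that] orth[OF mat_char_in_irr_chars[OF P]] by simp
  then show ?thesis by (rule zero[OF w])
qed

text \<open>With $T$ the normal operator of multiplication by the central element of $f$ and $S = T^*$: let $w = T\psi$ be
nonzero in a minimal invariant subspace of the range of $T$. Orthogonality gives $Tw = 0$, hence
$\|Sw\|^2 = \langle TSw, w\rangle = \langle STw, w\rangle = 0$ and
$\|w\|^2 = \langle T\psi, w\rangle = \langle \psi, Sw\rangle = 0$, a contradiction.\<close>

lemma twisted_class_fun_complete:
  assumes f: "twisted_class_fun f"
    and orth: "\<And>\<chi>. \<chi> \<in> irr_chars G \<alpha> \<Longrightarrow> (\<Sum>g\<in>carrier G. \<chi> g * cnj (f g)) = 0"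
    and x: "x \<in> carrier G"
  shows "f x = 0"
proof -
  interpret fs: vector_space "fun_scale :: complex \<Rightarrow> ('a \<Rightarrow> complex) \<Rightarrow> 'a \<Rightarrow> complex"
    by (rule fun_vector_space)
  define T where "T = lmult (\<lambda>g. cnj (f g))"
  define S where "S = lmult_adj (\<lambda>g. cnj (f g))"
  have lin_lreg: "lreg g (\<phi> + \<psi>) = lreg g \<phi> + lreg g \<psi>" "lreg g (fun_scale c \<phi>) = fun_scale c (lreg g \<phi>)"
    for g \<phi> \<psi> c by (auto simp: lreg_def fun_scale_def fun_eq_iff algebra_simps)
  have lin_T: "T (\<phi> + \<psi>) = T \<phi> + T \<psi>" "T (fun_scale c \<phi>) = fun_scale c (T \<phi>)" for \<phi> \<psi> c
    unfolding T_def lmult_def lin_lreg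
    by (auto simp: fun_scale_def fun_eq_iff algebra_simps sum.distrib sum_distrib_left)
  have T_sum: "T \<phi> = (\<Sum>g\<in>carrier G. fun_scale (cnj (f g)) (lreg g \<phi>))" for \<phi>
    by (auto simp: T_def lmult_def sum_fun_apply fun_scale_def fun_eq_iff)
  define D :: "('a \<Rightarrow> complex) set" where "D = (\<lambda>y x. if x = y then 1 else 0) ` carrier G"
  have finD: "finite D" using finite_group by (simp add: D_def)
  have spanD: "supported \<subseteq> fs.span D"
  proof
    fix \<phi> :: "'a \<Rightarrow> complex" assume \<phi>: "\<phi> \<in> supported"
    have "\<phi> = (\<Sum>y\<in>carrier G. fun_scale (\<phi> y) (\<lambda>x. if x = y then 1 else 0))"
    proof
      fix x
      have "(\<Sum>y\<in>carrier G. fun_scale (\<phi> y) (\<lambda>x. if x = y then 1 else 0)) x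
          = (\<Sum>y\<in>carrier G. if y = x then \<phi> y else 0)"
        unfolding sum_fun_apply by (intro sum.cong) (auto simp: fun_scale_def)
      then show "\<phi> x = (\<Sum>y\<in>carrier G. fun_scale (\<phi> y) (\<lambda>x. if x = y then 1 else 0)) x"
        using \<phi> finite_group by (auto simp: supported_def)
    qed
    also have "\<dots> \<in> fs.span D"
      by (intro fs.span_sum fs.span_scale fs.span_base) (auto simp: D_def)
    finally show "\<phi> \<in> fs.span D" .
  qed
  have T_zero: "T \<phi> = 0" if \<phi>0: "\<phi> \<in> supported" for \<phi>
  proof (rule ccontr)
    assume nz: "T \<phi> \<noteq> 0"
    define Q where "Q W \<longleftrightarrow> fs.subspace W \<and> W \<subseteq> T ` supported \<and> W \<noteq> {0} \<and>
        (\<forall>g\<in>carrier G. lreg g ` W \<subseteq> W)" for W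
    have "fs.subspace (T ` supported)"
    proof (rule fs.subspaceI)
      have "T (fun_scale 0 \<phi>) = fun_scale 0 (T \<phi>)" by (rule lin_T)
      then have "T (fun_scale 0 \<phi>) = 0" by simp
      moreover have "fun_scale 0 \<phi> \<in> supported" by (simp add: supported_def)
      ultimately show "0 \<in> T ` supported" by force
    next
      fix a b assume "a \<in> T ` supported" "b \<in> T ` supported"
      then obtain a' b' where ab: "a' \<in> supported" "b' \<in> supported" "a = T a'" "b = T b'" by blast
      have "a' + b' \<in> supported" using ab by (simp add: supported_def)
      then show "a + b \<in> T ` supported" using ab lin_T(1)[of a' b'] by (intro image_eqI[of _ _ "a' + b'"]) auto
    next
      fix c a assume "a \<in> T ` supported"
      then obtain a' where a: "a' \<in> supported" "a = T a'" by blast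
      have "fun_scale c a' \<in> supported" using a by (simp add: supported_def fun_scale_def)
      then show "fun_scale c a \<in> T ` supported"
        using a lin_T(2)[of c a'] by (intro image_eqI[of _ _ "fun_scale c a'"]) auto
    qed
    moreover have "T ` supported \<noteq> {0}" using nz \<phi>0 by blast
    moreover have "lreg g ` T ` supported \<subseteq> T ` supported" if "g \<in> carrier G" for g
      using lreg_lmult[OF f that] by (auto simp: T_def)
    ultimately have "Q (T ` supported)" unfolding Q_def by auto
    moreover have T_supp: "T ` supported \<subseteq> supported" by (auto simp: T_def)
    moreover have "fs.subspace W \<and> W \<subseteq> fs.span D" if "Q W" for W
      using that T_supp spanD unfolding Q_def by blast
    ultimately obtain W where W: "Q W" and min: "\<And>U. \<lbrakk>Q U; U \<subseteq> W\<rbrakk> \<Longrightarrow> U = W"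
      using fs.minimal_subspace[OF finD, of Q "T ` supported"] by blast
    have subW: "fs.subspace W" and WT: "W \<subseteq> T ` supported" and W0: "W \<noteq> {0}"
      and invW: "\<And>g w. \<lbrakk>g \<in> carrier G; w \<in> W\<rbrakk> \<Longrightarrow> lreg g w \<in> W"
      using W by (auto simp: Q_def)
    have Ws: "W \<subseteq> supported" using WT T_supp by blast
    have "\<exists>B. finite B \<and> fs.span B = W"
    proof -
      obtain B where B: "B \<subseteq> W" "fs.independent B" "W \<subseteq> fs.span B"
        using fs.maximal_independent_subset[of W] by blast
      have "B \<subseteq> fs.span D" using B(1) Ws spanD by blast
      then have "finite B" using fs.independent_span_bound[OF finD B(2)] by blast
      moreover have "fs.span B = W" using B fs.span_minimal[OF B(1) subW] by blast
      ultimately show ?thesis by blast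
    qed
    moreover have "bij_betw (lreg g) W W" if g: "g \<in> carrier G" for g
    proof (rule bij_betw_byWitness[where f'="\<lambda>\<phi>. fun_scale (1 / \<alpha> g (inv g)) (lreg (inv g) \<phi>)"])
      show "\<forall>w\<in>W. fun_scale (1 / \<alpha> g (inv g)) (lreg (inv g) (lreg g w)) = w"
        using g Ws by (auto simp: lreg_mult lreg_one multiplier_inv_commute fs.scale_scale)
      show "\<forall>w\<in>W. lreg g (fun_scale (1 / \<alpha> g (inv g)) (lreg (inv g) w)) = w"
        using g Ws by (auto simp: lin_lreg lreg_mult lreg_one fs.scale_scale)
    qed (use g invW subW in \<open>auto intro: fs.subspace_scale\<close>)
    ultimately have rep: "proj_rep G \<alpha> fun_scale W lreg"
      unfolding proj_rep_def fin_dim_space_def general_linear_def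
      using fun_vector_space subW W0 by (simp add: lin_lreg lreg_mult)
    have "U = {0} \<or> U = W" if "fs.subspace U" "U \<subseteq> W" "\<forall>g\<in>carrier G. lreg g ` U \<subseteq> U" for U
    proof (cases "U = {0}")
      case False
      have "Q U" unfolding Q_def using that WT False by (intro conjI) (blast+)
      with min that(2) show ?thesis by blast
    qed simp
    then have irr: "irreducible_proj_rep G \<alpha> fun_scale W lreg"
      using rep by (simp add: irreducible_proj_rep_def)
    obtain w where w: "w \<in> W" "w \<noteq> 0" using W0 fs.subspace_0[OF subW] by blast
    then obtain \<psi> where \<psi>: "\<psi> \<in> supported" "w = T \<psi>" using WT by blast
    have ws: "w \<in> supported" using w Ws by blast
    have "T w = 0" unfolding T_sum by (rule central_acts_zero_on_irreducible[OF irr f orth w(1)])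
    have "inner_G (S w) (S w) = inner_G (T (S w)) w"
      unfolding T_def S_def by (simp add: inner_lmult_adj)
    also have "T (S w) = S (T w)" unfolding T_def S_def by (rule lmult_normal[OF f ws])
    also have "S (T w) = 0" unfolding \<open>T w = 0\<close> by (auto simp: S_def lmult_adj_def lreg_adj_def fun_eq_iff)
    also have "inner_G 0 w = 0" by (simp add: inner_G_def)
    finally have "S w = 0" by (rule inner_G_self_zero[rotated]) (simp add: S_def)
    have "inner_G w w = inner_G \<psi> (S w)" using inner_lmult_adj \<psi>(2) by (simp add: T_def S_def)
    also have "\<dots> = 0" unfolding \<open>S w = 0\<close> by (simp add: inner_G_def)
    finally have "w = 0" using inner_G_self_zero[OF ws] by blast
    with w show False by blast
  qed
  \<comment> \<open>applied to the unit element of the algebra, \<open>T\<close> returns the coefficients of its central element\<close>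
  define \<delta> :: "'a \<Rightarrow> complex" where "\<delta> y = (if y = \<one> then 1 else 0)" for y
  have "\<delta> \<in> supported" by (auto simp: \<delta>_def supported_def)
  then have "T \<delta> x = 0" using T_zero by simp
  moreover have "T \<delta> x = (\<Sum>g\<in>carrier G. if g = x then cnj (f g) else 0)"
    unfolding T_def lmult_def
  proof (intro sum.cong refl)
    fix g assume g: "g \<in> carrier G"
    have "inv g \<otimes> x = \<one> \<longleftrightarrow> g = x"
      using g x by (metis inv_cancel(2) l_inv r_one)
    then show "cnj (f g) * lreg g \<delta> x = (if g = x then cnj (f g) else 0)"
      using g x by (auto simp: lreg_def \<delta>_def)
  qed
  ultimately show ?thesis using x finite_group by simp
qed

end

section \<open>Orthonormal families of vectors\<close>

definition cinner :: "nat \<Rightarrow> (nat \<Rightarrow> complex) \<Rightarrow> (nat \<Rightarrow> complex) \<Rightarrow> complex" where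
  "cinner m u v = (\<Sum>i<m. u i * cnj (v i))"

lemma cinner_diff_sum:
  "cinner m (\<lambda>k. u k - (\<Sum>\<chi>\<in>F. c \<chi> * e \<chi> k)) v = cinner m u v - (\<Sum>\<chi>\<in>F. c \<chi> * cinner m (e \<chi>) v)"
proof -
  have "(\<Sum>k<m. (\<Sum>\<chi>\<in>F. c \<chi> * e \<chi> k) * cnj (v k)) = (\<Sum>\<chi>\<in>F. c \<chi> * (\<Sum>k<m. e \<chi> k * cnj (v k)))"
    unfolding sum_distrib_right sum_distrib_left by (subst sum.swap) (simp add: mult.assoc)
  then show ?thesis by (simp add: cinner_def left_diff_distrib sum_subtractf)
qed

text \<open>The vector \<open>u\<close> is what remains of the \<open>i\<close>-th unit vector after projecting away the family. The second claim
is Pythagoras, a form of Bessel's inequality that keeps the error term.\<close>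

lemma orthonormal_residual:
  assumes F: "finite F" and on: "\<And>\<chi> \<psi>. \<lbrakk>\<chi> \<in> F; \<psi> \<in> F\<rbrakk> \<Longrightarrow> cinner m (e \<chi>) (e \<psi>) = (if \<chi> = \<psi> then 1 else 0)"
    and i: "i < m"
  defines "u \<equiv> \<lambda>k. (if k = i then 1 else 0) - (\<Sum>\<chi>\<in>F. cnj (e \<chi> i) * e \<chi> k)"
  shows "\<psi> \<in> F \<Longrightarrow> cinner m u (e \<psi>) = 0"
    and "(\<Sum>\<chi>\<in>F. (norm (e \<chi> i))\<^sup>2) + (\<Sum>k<m. (norm (u k))\<^sup>2) = 1"
proof -
  have unit: "cinner m (\<lambda>k. if k = i then 1 else 0) v = cnj (v i)" for v
  proof -
    have "cinner m (\<lambda>k. if k = i then 1 else 0) v = (\<Sum>k<m. if k = i then cnj (v k) else 0)"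
      unfolding cinner_def by (intro sum.cong) auto
    then show ?thesis using i by simp
  qed
  show orth: "cinner m u (e \<psi>) = 0" if "\<psi> \<in> F" for \<psi>
  proof -
    have "(\<Sum>\<chi>\<in>F. cnj (e \<chi> i) * cinner m (e \<chi>) (e \<psi>)) = (\<Sum>\<chi>\<in>F. if \<chi> = \<psi> then cnj (e \<chi> i) else 0)"
      using on that by (intro sum.cong) auto
    then show ?thesis unfolding u_def cinner_diff_sum unit using F that by simp
  qed
  have swap: "cinner m v w = cnj (cinner m w v)" for v w
    by (simp add: cinner_def mult.commute)
  have "cinner m u u = cnj (u i) - (\<Sum>\<chi>\<in>F. cnj (e \<chi> i) * cinner m (e \<chi>) u)"
    by (subst (1) u_def) (simp add: cinner_diff_sum unit)
  also have "\<dots> = cnj (u i)" using orth by (subst swap) simp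
  finally have 1: "cinner m u u = 1 - complex_of_real (\<Sum>\<chi>\<in>F. (norm (e \<chi> i))\<^sup>2)"
    by (simp add: u_def complex_norm_square del: of_real_power)
  have 2: "cinner m u u = complex_of_real (\<Sum>k<m. (norm (u k))\<^sup>2)"
    by (simp add: cinner_def complex_norm_square del: of_real_power)
  have "complex_of_real ((\<Sum>\<chi>\<in>F. (norm (e \<chi> i))\<^sup>2) + (\<Sum>k<m. (norm (u k))\<^sup>2)) = complex_of_real 1"
    using 1 unfolding 2 by simp
  then show "(\<Sum>\<chi>\<in>F. (norm (e \<chi> i))\<^sup>2) + (\<Sum>k<m. (norm (u k))\<^sup>2) = 1"
    unfolding of_real_eq_iff .
qed

text \<open>Count $\sum_{i,\chi} |e_\chi(i)|^2$ in two ways. Each $\chi$ contributes $1$; each coordinate $i$ contributes at most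
$1$ by Bessel, and exactly $1$ when the family is complete.\<close>

lemma orthonormal_basis_card:
  assumes on: "\<And>\<chi> \<psi>. \<lbrakk>\<chi> \<in> I; \<psi> \<in> I\<rbrakk> \<Longrightarrow> cinner m (e \<chi>) (e \<psi>) = (if \<chi> = \<psi> then 1 else 0)"
    and complete: "\<And>u i. \<lbrakk>\<And>\<psi>. \<psi> \<in> I \<Longrightarrow> cinner m u (e \<psi>) = 0; i < m\<rbrakk> \<Longrightarrow> u i = 0"
  shows "finite I" "card I = m"
proof -
  have norm1: "(\<Sum>i<m. (norm (e \<chi> i))\<^sup>2) = 1" if "\<chi> \<in> I" for \<chi>
  proof -
    have "complex_of_real (\<Sum>i<m. (norm (e \<chi> i))\<^sup>2) = cinner m (e \<chi>) (e \<chi>)"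
      by (simp add: cinner_def complex_norm_square del: of_real_power)
    also have "\<dots> = complex_of_real 1" using on that by simp
    finally show ?thesis unfolding of_real_eq_iff .
  qed
  have total: "(\<Sum>i<m. \<Sum>\<chi>\<in>F. (norm (e \<chi> i))\<^sup>2) = real (card F)" if "F \<subseteq> I" for F
    using that by (subst sum.swap) (simp add: norm1 subset_iff)
  have bessel: "card F \<le> m" if F: "finite F" "F \<subseteq> I" for F
  proof -
    have "(\<Sum>\<chi>\<in>F. (norm (e \<chi> i))\<^sup>2) \<le> 1" if "i < m" for i
    proof -
      let ?u = "\<lambda>k. (if k = i then 1 else 0) - (\<Sum>\<chi>\<in>F. cnj (e \<chi> i) * e \<chi> k)"
      have "(\<Sum>\<chi>\<in>F. (norm (e \<chi> i))\<^sup>2) + (\<Sum>k<m. (norm (?u k))\<^sup>2) = 1"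
        by (rule orthonormal_residual(2)[OF F(1) on[OF subsetD[OF F(2)] subsetD[OF F(2)]] that])
      moreover have "0 \<le> (\<Sum>k<m. (norm (?u k))\<^sup>2)" by (simp add: sum_nonneg)
      ultimately show ?thesis by linarith
    qed
    then have "(\<Sum>i<m. \<Sum>\<chi>\<in>F. (norm (e \<chi> i))\<^sup>2) \<le> (\<Sum>i<m. 1)" by (intro sum_mono) auto
    then show ?thesis unfolding total[OF F(2)] by simp
  qed
  show fin: "finite I"
  proof (rule ccontr)
    assume "infinite I"
    then obtain F where "F \<subseteq> I" "finite F" "card F = Suc m"
      using infinite_arbitrarily_large by blast
    then show False using bessel[of F] by simp
  qed
  have "(\<Sum>\<chi>\<in>I. (norm (e \<chi> i))\<^sup>2) = 1" if i: "i < m" for i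
  proof -
    let ?u = "\<lambda>k. (if k = i then 1 else 0) - (\<Sum>\<chi>\<in>I. cnj (e \<chi> i) * e \<chi> k)"
    have "cinner m ?u (e \<psi>) = 0" if "\<psi> \<in> I" for \<psi>
      by (rule orthonormal_residual(1)[OF fin on i that])
    then have "?u k = 0" if "k < m" for k using complete[of ?u k] that by blast
    then have "(\<Sum>k<m. (norm (?u k))\<^sup>2) = 0" by simp
    moreover have "(\<Sum>\<chi>\<in>I. (norm (e \<chi> i))\<^sup>2) + (\<Sum>k<m. (norm (?u k))\<^sup>2) = 1"
      by (rule orthonormal_residual(2)[OF fin on i])
    ultimately show ?thesis by linarith
  qed
  then have "(\<Sum>i<m. \<Sum>\<chi>\<in>I. (norm (e \<chi> i))\<^sup>2) = real m" by simp
  then show "card I = m" unfolding total[OF order_refl] by simp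
qed

section \<open>Class matrices and character vectors\<close>

locale indexed_regular_classes = unitary_twist +
  fixes m :: nat and C :: "nat \<Rightarrow> 'a set" and c\<^sub>0 :: "nat \<Rightarrow> 'a"
  assumes classes: "bij_betw C {..<m} (regular_classes G \<alpha>)"
    and representative: "\<And>i. i < m \<Longrightarrow> c\<^sub>0 i \<in> C i"
begin

abbreviation "wt i x \<equiv> beta_pair G \<alpha> (c\<^sub>0 i) x"

lemma class_regular:
  assumes "i < m" "x \<in> C i" shows "regular_elem G \<alpha> x"
  using assms classes by (auto simp: bij_betw_def regular_classes_def)

lemma class_carrier: "\<lbrakk>i < m; x \<in> C i\<rbrakk> \<Longrightarrow> x \<in> carrier G"
  using class_regular regular_carrier by blast

lemma class_eq:
  assumes "i < m" shows "C i = conj_class G (c\<^sub>0 i)"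
proof -
  have "C i \<in> regular_classes G \<alpha>" using classes assms by (auto simp: bij_betw_def)
  then obtain g where g: "g \<in> carrier G" "C i = conj_class G g" by (auto simp: regular_classes_def)
  then show ?thesis using conj_class_eq[OF g(1)] representative[OF assms] by simp
qed

lemma class_disjoint:
  assumes "i < m" "j < m" "x \<in> C i" "x \<in> C j" shows "i = j"
proof -
  have "C i = conj_class G x" "C j = conj_class G x"
    using assms class_eq conj_class_eq class_carrier representative by metis+
  then show ?thesis using classes assms by (auto simp: bij_betw_def inj_on_def)
qed

lemma regular_in_class:
  assumes "regular_elem G \<alpha> g" obtains i where "i < m" "g \<in> C i"
proof -
  have "conj_class G g \<in> C ` {..<m}"
    using regular_class_of_regular[OF assms] classes by (simp add: bij_betw_def)
  then obtain i where "i < m" "conj_class G g = C i" by auto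
  then show thesis using that conj_class_self[OF regular_carrier[OF assms]] by blast
qed

lemma finite_class: "i < m \<Longrightarrow> finite (C i)"
  using finite_group class_carrier by (meson finite_subset subsetI)

lemma card_class_pos: "i < m \<Longrightarrow> card (C i) > 0"
  using finite_class representative by (auto simp: card_gt_0_iff)

lemma class_conj_iff:
  assumes "i < m" "x \<in> carrier G" "h \<in> carrier G"
  shows "h \<otimes> x \<otimes> inv h \<in> C i \<longleftrightarrow> x \<in> C i"
proof -
  have closed: "k \<otimes> y \<otimes> inv k \<in> C i" if "y \<in> C i" "k \<in> carrier G" for y k
  proof -
    have "conj_class G y = C i"
      using class_eq[OF assms(1)] conj_class_eq[OF class_carrier[OF assms(1) representative[OF assms(1)]]] that
      by simp
    then show ?thesis using that by (auto simp: conj_class_def)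
  qed
  have "inv h \<otimes> (h \<otimes> x \<otimes> inv h) \<otimes> inv (inv h) = x" using assms by (simp add: m_assoc)
  then show ?thesis using closed[of x h] closed[of "h \<otimes> x \<otimes> inv h" "inv h"] assms by auto
qed

lemma rep_regular: "i < m \<Longrightarrow> regular_elem G \<alpha> (c\<^sub>0 i)"
  using class_regular representative by blast

lemma in_class_conj:
  assumes "i < m" "x \<in> C i" obtains h where "h \<in> carrier G" "x = h \<otimes> c\<^sub>0 i \<otimes> inv h"
  using assms class_eq by (auto simp: conj_class_def)

lemma wt_twisted:
  assumes "i < m" "x \<in> C i" "h \<in> carrier G"
  shows "wt i (h \<otimes> x \<otimes> inv h) = \<beta> h x * wt i x"
proof -
  obtain k where k: "k \<in> carrier G" "x = k \<otimes> c\<^sub>0 i \<otimes> inv k" using in_class_conj assms by blast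
  have c: "c\<^sub>0 i \<in> carrier G" using rep_regular[OF assms(1)] regular_carrier by blast
  have "h \<otimes> x \<otimes> inv h = (h \<otimes> k) \<otimes> c\<^sub>0 i \<otimes> inv (h \<otimes> k)"
    using k assms c by (simp add: m_assoc inv_mult_group)
  then have "wt i (h \<otimes> x \<otimes> inv h) = \<beta> (h \<otimes> k) (c\<^sub>0 i)"
    using beta_pair_conj[OF rep_regular[OF assms(1)], of "h \<otimes> k"] assms k by simp
  also have "\<dots> = \<beta> h x * \<beta> k (c\<^sub>0 i)" using beta_mult[OF c assms(3) k(1)] k by simp
  finally show ?thesis using beta_pair_conj[OF rep_regular[OF assms(1)] k(1)] k by simp
qed

lemma norm_wt [simp]:
  assumes "i < m" "x \<in> C i" shows "norm (wt i x) = 1"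
proof -
  obtain k where k: "k \<in> carrier G" "x = k \<otimes> c\<^sub>0 i \<otimes> inv k" using in_class_conj assms by blast
  then show ?thesis
    using beta_pair_conj[OF rep_regular[OF assms(1)] k(1)] regular_carrier[OF rep_regular[OF assms(1)]]
    by simp
qed

lemma wt_cnj [simp]:
  assumes "i < m" "x \<in> C i" shows "wt i x * cnj (wt i x) = 1" "cnj (wt i x) * wt i x = 1"
  using norm_wt[OF assms] by (simp_all add: complex_norm_square[symmetric] mult.commute)

lemma inverse_wt:
  assumes "i < m" "x \<in> C i" shows "inverse (wt i x) = cnj (wt i x)"
  using wt_cnj[OF assms] by (metis inverse_unique)

lemma wt_representative:
  assumes "i < m" shows "wt i (c\<^sub>0 i) = 1"
proof -
  have c: "c\<^sub>0 i \<in> carrier G" using rep_regular[OF assms] regular_carrier by blast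
  then have "wt i (c\<^sub>0 i) = \<beta> \<one> (c\<^sub>0 i)"
    using beta_pair_conj[OF rep_regular[OF assms], of \<one>] by simp
  then show ?thesis using c by (simp add: beta_conj_def)
qed

lemma twisted_class_fun_on_class:
  assumes f: "twisted_class_fun f" and "i < m" "x \<in> C i"
  shows "f x = wt i x * f (c\<^sub>0 i)"
proof -
  obtain k where k: "k \<in> carrier G" "x = k \<otimes> c\<^sub>0 i \<otimes> inv k" using in_class_conj assms by blast
  then show ?thesis
    using f beta_pair_conj[OF rep_regular[OF assms(2)] k(1)] regular_carrier[OF rep_regular[OF assms(2)]]
    by (simp add: twisted_class_fun_def)
qed

text \<open>The conjugates of these values are the coefficients of the central class sums $z_A$.\<close>

definition class_fun :: "nat \<Rightarrow> 'a \<Rightarrow> complex" where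
  "class_fun i x = (if x \<in> C i then wt i x else 0)"

lemma twisted_class_fun_class_fun: "i < m \<Longrightarrow> twisted_class_fun (class_fun i)"
  by (auto simp: twisted_class_fun_def class_fun_def class_conj_iff wt_twisted)

lemma twisted_mat_char: "irr_mat d P \<Longrightarrow> twisted_class_fun (mat_char d P)"
  by (simp add: twisted_class_fun_def mat_char_conj)

lemma sum_class:
  assumes "i < m" shows "(\<Sum>x\<in>carrier G. if x \<in> C i then f x else 0) = (\<Sum>x\<in>C i. f x)"
  using finite_group class_carrier[OF assms]
  by (subst sum.inter_restrict[symmetric]) (auto intro!: sum.cong)

lemma inner_class_fun:
  assumes f: "twisted_class_fun f" and i: "i < m"
  shows "(\<Sum>x\<in>carrier G. f x * cnj (class_fun i x)) = of_nat (card (C i)) * f (c\<^sub>0 i)"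
proof -
  have "(\<Sum>x\<in>carrier G. f x * cnj (class_fun i x)) = (\<Sum>x\<in>C i. f x * cnj (wt i x))"
    unfolding sum_class[OF i, symmetric] by (intro sum.cong) (auto simp: class_fun_def)
  also have "\<dots> = (\<Sum>x\<in>C i. (wt i x * cnj (wt i x)) * f (c\<^sub>0 i))"
    by (intro sum.cong refl) (simp only: twisted_class_fun_on_class[OF f i] mult_ac)
  also have "\<dots> = of_nat (card (C i)) * f (c\<^sub>0 i)" using i by simp
  finally show ?thesis .
qed

lemma class_fun_expansion:
  assumes f: "twisted_class_fun f" and x: "x \<in> carrier G"
    and nr: "\<not> regular_elem G \<alpha> x \<Longrightarrow> f x = 0"
  shows "f x = (\<Sum>i<m. f (c\<^sub>0 i) * class_fun i x)"
proof (cases "regular_elem G \<alpha> x")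
  case True
  then obtain j where j: "j < m" "x \<in> C j" using regular_in_class by blast
  have "(\<Sum>i<m. f (c\<^sub>0 i) * class_fun i x) = (\<Sum>i<m. if i = j then f (c\<^sub>0 i) * wt i x else 0)"
    using class_disjoint j by (intro sum.cong) (auto simp: class_fun_def)
  then show ?thesis using j twisted_class_fun_on_class[OF f j] by simp
next
  case False
  then have "class_fun i x = 0" if "i < m" for i using class_regular that by (auto simp: class_fun_def)
  then show ?thesis using nr False by simp
qed

abbreviation "v \<equiv> char_vec G m C c\<^sub>0"
abbreviation "M \<equiv> class_mat G \<alpha> m C c\<^sub>0"
abbreviation "sz i \<equiv> real (card (C i))"
abbreviation "n \<equiv> real (card (carrier G))"

lemma card_group_pos: "card (carrier G) > 0"
  using finite_group by (auto simp: card_gt_0_iff)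

lemma char_vec_index: "i < m \<Longrightarrow> v \<chi> $ i = \<chi> (c\<^sub>0 i) * of_real (sqrt (sz i / n))"
  by (simp add: char_vec_def)

lemma char_vec_carrier [simp]: "v \<chi> \<in> carrier_vec m" "dim_vec (v \<chi>) = m"
  by (simp_all add: char_vec_def)

text \<open>Expanding $\psi$ in class functions turns the sum over the group into a sum over regular classes, each
weighted by its size; the factors $\sqrt{|C|/|G|}$ absorb these weights.\<close>

lemma char_vec_orthonormal:
  assumes "\<chi> \<in> irr_chars G \<alpha>" "\<psi> \<in> irr_chars G \<alpha>"
  shows "cinner m (($) (v \<chi>)) (($) (v \<psi>)) = (if \<chi> = \<psi> then 1 else 0)"
proof -
  obtain d P where P: "irr_mat d P" "\<chi> = mat_char d P" using irr_char_matrix_form assms by blast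
  obtain d' P' where P': "irr_mat d' P'" "\<psi> = mat_char d' P'" using irr_char_matrix_form assms by blast
  have "(\<Sum>g\<in>carrier G. \<chi> g * cnj (\<psi> g))
      = (\<Sum>g\<in>carrier G. \<Sum>i<m. cnj (\<psi> (c\<^sub>0 i)) * (\<chi> g * cnj (class_fun i g)))"
  proof (intro sum.cong refl)
    fix g assume g: "g \<in> carrier G"
    have "\<psi> g = (\<Sum>i<m. \<psi> (c\<^sub>0 i) * class_fun i g)"
      unfolding P'(2)
      by (rule class_fun_expansion[OF twisted_mat_char[OF P'(1)] g mat_char_nonregular[OF P'(1) g]])
    then show "\<chi> g * cnj (\<psi> g) = (\<Sum>i<m. cnj (\<psi> (c\<^sub>0 i)) * (\<chi> g * cnj (class_fun i g)))"
      by (simp add: sum_distrib_left mult_ac)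
  qed
  also have "\<dots> = (\<Sum>i<m. cnj (\<psi> (c\<^sub>0 i)) * (\<Sum>g\<in>carrier G. \<chi> g * cnj (class_fun i g)))"
    by (subst sum.swap) (simp add: sum_distrib_left)
  also have "\<dots> = (\<Sum>i<m. cnj (\<psi> (c\<^sub>0 i)) * (of_nat (card (C i)) * \<chi> (c\<^sub>0 i)))"
    using inner_class_fun[OF twisted_mat_char[OF P(1)]] P(2) by simp
  also have "\<dots> = of_real n * cinner m (($) (v \<chi>)) (($) (v \<psi>))"
    unfolding cinner_def sum_distrib_left
  proof (intro sum.cong refl)
    fix i assume "i \<in> {..<m}"
    then have i: "i < m" by simp
    have "complex_of_real (sqrt (sz i / n)) * complex_of_real (sqrt (sz i / n)) = of_real (sz i / n)"
      unfolding of_real_mult[symmetric] by simp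
    then have "of_real n * (v \<chi> $ i * cnj (v \<psi> $ i))
        = of_real n * of_real (sz i / n) * (\<chi> (c\<^sub>0 i) * cnj (\<psi> (c\<^sub>0 i)))"
      unfolding char_vec_index[OF i] by (simp add: mult_ac)
    also have "of_real n * of_real (sz i / n) = (of_nat (card (C i)) :: complex)"
      using card_group_pos by (simp flip: of_real_mult)
    finally show "cnj (\<psi> (c\<^sub>0 i)) * (of_nat (card (C i)) * \<chi> (c\<^sub>0 i))
        = of_real n * (v \<chi> $ i * cnj (v \<psi> $ i))" by (simp add: mult_ac)
  qed
  finally have "of_real n * cinner m (($) (v \<chi>)) (($) (v \<psi>)) = (\<Sum>g\<in>carrier G. \<chi> g * cnj (\<psi> g))" ..
  also have "\<dots> = (if \<chi> = \<psi> then of_real n else 0)"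
    using mat_char_norm[OF P(1)] mat_char_orthogonal[OF P(1) P'(1)] P(2) P'(2) by auto
  finally show ?thesis using card_group_pos by (auto split: if_splits)
qed

text \<open>A vector corresponds to a twisted class function supported on the regular classes, and the inner products with
the $v_\chi$ to those with the $\chi$.\<close>

lemma char_vec_complete:
  assumes u: "\<And>\<chi>. \<chi> \<in> irr_chars G \<alpha> \<Longrightarrow> cinner m u (($) (v \<chi>)) = 0" and i: "i < m"
  shows "u i = 0"
proof -
  define f where "f x = (\<Sum>i<m. u i / of_real (sqrt (sz i)) * class_fun i x)" for x
  have tw: "twisted_class_fun f"
    using twisted_class_fun_class_fun
    by (auto simp: f_def twisted_class_fun_def sum_distrib_left mult_ac intro!: sum.cong)
  have "(\<Sum>g\<in>carrier G. \<chi> g * cnj (f g)) = 0" if \<chi>: "\<chi> \<in> irr_chars G \<alpha>" for \<chi>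
  proof -
    obtain d P where P: "irr_mat d P" "\<chi> = mat_char d P" using irr_char_matrix_form \<chi> by blast
    have "(\<Sum>g\<in>carrier G. \<chi> g * cnj (f g))
        = (\<Sum>g\<in>carrier G. \<Sum>i<m. cnj (u i) / of_real (sqrt (sz i)) * (\<chi> g * cnj (class_fun i g)))"
      by (simp add: f_def sum_distrib_left mult_ac)
    also have "\<dots> = (\<Sum>i<m. cnj (u i) / of_real (sqrt (sz i)) * (\<Sum>g\<in>carrier G. \<chi> g * cnj (class_fun i g)))"
      by (subst sum.swap) (simp add: sum_distrib_left)
    also have "\<dots> = (\<Sum>i<m. of_real (sqrt n) * cnj (u i * cnj (v \<chi> $ i)))"
    proof (intro sum.cong refl)
      fix i assume "i \<in> {..<m}"
      then have i: "i < m" by simp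
      have s: "sqrt (sz i) > 0" "sqrt n > 0" "(of_nat (card (C i)) :: complex) = of_real (sqrt (sz i)) * of_real (sqrt (sz i))"
        using card_class_pos[OF i] card_group_pos by (auto simp flip: of_real_mult)
      show "cnj (u i) / of_real (sqrt (sz i)) * (\<Sum>g\<in>carrier G. \<chi> g * cnj (class_fun i g))
          = of_real (sqrt n) * cnj (u i * cnj (v \<chi> $ i))"
        using inner_class_fun[OF twisted_mat_char[OF P(1)] i] s(1,2) unfolding P(2)[symmetric]
        by (simp add: char_vec_index[OF i] s(3) real_sqrt_divide)
    qed
    also have "\<dots> = of_real (sqrt n) * cnj (cinner m u (($) (v \<chi>)))"
      by (simp add: cinner_def sum_distrib_left)
    finally show ?thesis using u[OF \<chi>] by simp
  qed
  then have "f (c\<^sub>0 i) = 0"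
    using twisted_class_fun_complete[OF tw] class_carrier[OF i representative[OF i]] by blast
  moreover have "f (c\<^sub>0 i) = (\<Sum>j<m. if j = i then u j / of_real (sqrt (sz j)) else 0)"
    unfolding f_def using representative[OF i] class_disjoint[OF i] wt_representative
    by (intro sum.cong) (auto simp: class_fun_def)
  ultimately have "u i / of_real (sqrt (sz i)) = 0" using i by simp
  then show ?thesis using card_class_pos[OF i] by simp
qed

lemma class_mat_carrier [simp]: "M k \<in> carrier_mat m m" "dim_row (M k) = m" "dim_col (M k) = m"
  by (simp_all add: class_mat_def)

text \<open>By $\chi(ab) = \beta(c_0,ab)\chi(c_0)$, the summands of row $B$ against $v_\chi$ run over all pairs $(a,b) \in A \times B$
with $ab$ regular. The other pairs may be included because $\chi(ab) = 0$ there. The total is the trace of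
$z_A z_B$ up to the factor \<open>r\<close>, and both central elements act as known scalars.\<close>

lemma class_mat_eigen:
  assumes P: "irr_mat d P" and k: "k < m" and i: "i < m"
  defines "\<chi> \<equiv> mat_char d P"
  shows "(\<Sum>j<m. M k $$ (i, j) * v \<chi> $ j) = of_nat (card (C k)) * \<chi> (c\<^sub>0 k) / of_nat d * v \<chi> $ i"
proof -
  have d: "0 < d" using P by (simp add: irr_mat_def)
  define t where "t = (\<lambda>(a, b). cnj (wt k a) * cnj (wt i b) * (\<alpha> a b * \<chi> (a \<otimes> b)))"
  define r where "r = complex_of_real (1 / (sqrt (sz i) * sqrt n))"
  have entry: "M k $$ (i, j) * v \<chi> $ j
      = r * (\<Sum>p\<in>C k \<times> C i. if fst p \<otimes> snd p \<in> C j then t p else 0)" if j: "j < m" for j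
  proof -
    let ?S = "{(a, b). a \<in> C k \<and> b \<in> C i \<and> a \<otimes> b \<in> C j}"
    have pos: "sqrt (sz i) > 0" "sqrt (sz j) > 0" "sqrt n > 0"
      using card_class_pos[OF i] card_class_pos[OF j] card_group_pos by auto
    have "1 / sqrt (sz i * sz j) * sqrt (sz j / n) = 1 / (sqrt (sz i) * sqrt n)"
      using pos by (simp add: real_sqrt_mult real_sqrt_divide)
    then have r: "complex_of_real (1 / sqrt (sz i * sz j)) * complex_of_real (sqrt (sz j / n)) = r"
      unfolding r_def of_real_mult[symmetric] by simp
    have "M k $$ (i, j) * v \<chi> $ j = (complex_of_real (1 / sqrt (sz i * sz j)) * complex_of_real (sqrt (sz j / n)))
       * (\<Sum>(a, b)\<in>?S. wt j (a \<otimes> b) / (wt k a * wt i b) * \<alpha> a b * \<chi> (c\<^sub>0 j))"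
      using i j by (simp add: class_mat_def char_vec_index case_prod_beta sum_distrib_right sum_distrib_left mult_ac)
    also have "(\<Sum>(a, b)\<in>?S. wt j (a \<otimes> b) / (wt k a * wt i b) * \<alpha> a b * \<chi> (c\<^sub>0 j)) = (\<Sum>p\<in>?S. t p)"
    proof (intro sum.cong refl, clarify)
      fix a b assume ab: "a \<in> C k" "b \<in> C i" "a \<otimes> b \<in> C j"
      have "\<chi> (a \<otimes> b) = wt j (a \<otimes> b) * \<chi> (c\<^sub>0 j)"
        unfolding \<chi>_def by (rule twisted_class_fun_on_class[OF twisted_mat_char[OF P] j ab(3)])
      then show "wt j (a \<otimes> b) / (wt k a * wt i b) * \<alpha> a b * \<chi> (c\<^sub>0 j) = t (a, b)"
        using inverse_wt[OF k ab(1)] inverse_wt[OF i ab(2)]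
        by (simp add: t_def divide_inverse mult_ac)
    qed
    also have "?S = {p \<in> C k \<times> C i. fst p \<otimes> snd p \<in> C j}" by auto
    also have "(\<Sum>p\<in>{p \<in> C k \<times> C i. fst p \<otimes> snd p \<in> C j}. t p)
        = (\<Sum>p\<in>C k \<times> C i. if fst p \<otimes> snd p \<in> C j then t p else 0)"
      using finite_class[OF k] finite_class[OF i] by (intro sum.inter_filter) auto
    finally show ?thesis unfolding r .
  qed
  have "(\<Sum>j<m. M k $$ (i, j) * v \<chi> $ j)
      = r * (\<Sum>p\<in>C k \<times> C i. \<Sum>j<m. if fst p \<otimes> snd p \<in> C j then t p else 0)"
    using entry by (simp add: sum_distrib_left[symmetric]) (subst sum.swap, simp)
  also have "(\<Sum>p\<in>C k \<times> C i. \<Sum>j<m. if fst p \<otimes> snd p \<in> C j then t p else 0) = (\<Sum>p\<in>C k \<times> C i. t p)"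
  proof (intro sum.cong refl, clarify)
    fix a b assume ab: "a \<in> C k" "b \<in> C i"
    then have c: "a \<otimes> b \<in> carrier G" using class_carrier k i by blast
    show "(\<Sum>j<m. if fst (a, b) \<otimes> snd (a, b) \<in> C j then t (a, b) else 0) = t (a, b)"
    proof (cases "regular_elem G \<alpha> (a \<otimes> b)")
      case True
      then obtain l where l: "l < m" "a \<otimes> b \<in> C l" using regular_in_class by blast
      have "(\<Sum>j<m. if fst (a, b) \<otimes> snd (a, b) \<in> C j then t (a, b) else 0)
          = (\<Sum>j<m. if j = l then t (a, b) else 0)"
        using class_disjoint l by (intro sum.cong) auto
      then show ?thesis using l by simp
    next
      case False
      then show ?thesis using mat_char_nonregular[OF P c] by (simp add: t_def \<chi>_def)
    qed
  qed
  also have "(\<Sum>p\<in>C k \<times> C i. t p) = (\<Sum>a\<in>C k. \<Sum>b\<in>C i. t (a, b))"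
    by (simp add: sum.cartesian_product)
  also have "\<dots> = (\<Sum>a\<in>carrier G. \<Sum>b\<in>carrier G.
      cnj (class_fun k a) * cnj (class_fun i b) * (\<alpha> a b * \<chi> (a \<otimes> b)))"
    unfolding sum_class[OF k, symmetric] sum_class[OF i, symmetric]
    by (intro sum.cong refl) (auto simp: t_def class_fun_def intro!: sum.cong)
  also have "\<dots> = (\<Sum>a\<in>carrier G. \<Sum>b\<in>carrier G. \<Sum>l<d.
      cnj (class_fun k a) * cnj (class_fun i b) * mmul d (P a) (P b) l l)"
    by (intro sum.cong refl) (simp add: irr_mat_mmul[OF P] \<chi>_def mat_char_def sum_distrib_left)
  also have "\<dots> = (\<Sum>l<d. \<Sum>a\<in>carrier G. \<Sum>b\<in>carrier G.
      cnj (class_fun k a) * cnj (class_fun i b) * mmul d (P a) (P b) l l)"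
    by (subst (2) sum.swap, subst sum.swap) simp
  also have "\<dots> = (\<Sum>l<d. mmul d (\<lambda>i j. \<Sum>a\<in>carrier G. cnj (class_fun k a) * P a i j)
      (\<lambda>i' j. \<Sum>b\<in>carrier G. cnj (class_fun i b) * P b i' j) l l)"
  proof (intro sum.cong refl)
    fix l
    have "(\<Sum>a\<in>carrier G. \<Sum>b\<in>carrier G. cnj (class_fun k a) * cnj (class_fun i b) * mmul d (P a) (P b) l l)
      = (\<Sum>a\<in>carrier G. \<Sum>b\<in>carrier G. \<Sum>q<d. (cnj (class_fun k a) * P a l q) * (cnj (class_fun i b) * P b q l))"
      by (simp add: mmul_def sum_distrib_left mult_ac)
    also have "\<dots> = (\<Sum>a\<in>carrier G. \<Sum>q<d. \<Sum>b\<in>carrier G. (cnj (class_fun k a) * P a l q) * (cnj (class_fun i b) * P b q l))"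
      by (intro sum.cong refl sum.swap)
    also have "\<dots> = (\<Sum>q<d. \<Sum>a\<in>carrier G. \<Sum>b\<in>carrier G. (cnj (class_fun k a) * P a l q) * (cnj (class_fun i b) * P b q l))"
      by (rule sum.swap)
    finally show "(\<Sum>a\<in>carrier G. \<Sum>b\<in>carrier G. cnj (class_fun k a) * cnj (class_fun i b) * mmul d (P a) (P b) l l)
      = mmul d (\<lambda>i j. \<Sum>a\<in>carrier G. cnj (class_fun k a) * P a i j)
      (\<lambda>i' j. \<Sum>b\<in>carrier G. cnj (class_fun i b) * P b i' j) l l"
      by (simp add: mmul_def sum_product)
  qed
  also have "\<dots> = (\<Sum>l<d. (of_nat (card (C k)) * \<chi> (c\<^sub>0 k) / of_nat d) * (of_nat (card (C i)) * \<chi> (c\<^sub>0 i) / of_nat d))"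
  proof (intro sum.cong refl)
    fix l assume "l \<in> {..<d}"
    then have l: "l < d" by simp
    have Z: "(\<Sum>g\<in>carrier G. cnj (class_fun q g) * P g x y)
        = (if x = y then of_nat (card (C q)) * \<chi> (c\<^sub>0 q) / of_nat d else 0)"
      if "q < m" "x < d" "y < d" for q x y
      using central_sum_scalar[OF P twisted_class_fun_class_fun[OF that(1)] that(2,3)]
        inner_class_fun[OF twisted_mat_char[OF P] that(1)] by (simp add: \<chi>_def)
    have "mmul d (\<lambda>i j. \<Sum>a\<in>carrier G. cnj (class_fun k a) * P a i j)
        (\<lambda>i' j. \<Sum>b\<in>carrier G. cnj (class_fun i b) * P b i' j) l l
      = (\<Sum>q<d. if q = l then (of_nat (card (C k)) * \<chi> (c\<^sub>0 k) / of_nat d) * (of_nat (card (C i)) * \<chi> (c\<^sub>0 i) / of_nat d) else 0)"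
      unfolding mmul_def using l by (intro sum.cong refl) (auto simp: Z[OF k] Z[OF i])
    then show "mmul d (\<lambda>i j. \<Sum>a\<in>carrier G. cnj (class_fun k a) * P a i j)
        (\<lambda>i' j. \<Sum>b\<in>carrier G. cnj (class_fun i b) * P b i' j) l l
      = (of_nat (card (C k)) * \<chi> (c\<^sub>0 k) / of_nat d) * (of_nat (card (C i)) * \<chi> (c\<^sub>0 i) / of_nat d)"
      using l by simp
  qed
  also have "\<dots> = (of_nat (card (C k)) * \<chi> (c\<^sub>0 k) / of_nat d) * (of_nat (card (C i)) * \<chi> (c\<^sub>0 i))"
    using d by simp
  also have "r * \<dots> = of_nat (card (C k)) * \<chi> (c\<^sub>0 k) / of_nat d * v \<chi> $ i"
  proof -
    have s: "sqrt (sz i) > 0" "sqrt n > 0" using card_class_pos[OF i] card_group_pos by auto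
    have "1 / (sqrt (sz i) * sqrt n) * sz i = sqrt (sz i / n)"
      using s by (simp add: real_sqrt_divide field_simps)
    then have "r * of_nat (card (C i)) = of_real (sqrt (sz i / n))"
      unfolding r_def by (metis of_real_mult of_real_of_nat_eq)
    then show ?thesis unfolding char_vec_index[OF i] by (simp add: mult_ac)
  qed
  finally show ?thesis .
qed

end

section \<open>Joint eigenvectors\<close>

lemma mat_adjoint_index:
  assumes "A \<in> carrier_mat m m" "i < m" "j < m"
  shows "mat_adjoint A $$ (i, j) = cnj (A $$ (j, i))"
  using assms by (simp add: mat_adjoint_def mat_of_rows_def)

lemma mat_adjoint_carrier:
  "A \<in> carrier_mat m m \<Longrightarrow> mat_adjoint A \<in> carrier_mat m m"
  by (auto simp: mat_adjoint_def mat_of_rows_def)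

lemma mult_mat_vec_index_sum:
  assumes "A \<in> carrier_mat m m" "u \<in> carrier_vec m" "i < m"
  shows "(A *\<^sub>v u) $ i = (\<Sum>j<m. A $$ (i, j) * u $ j)"
  using assms by (simp add: scalar_prod_def atLeast0LessThan)

lemma cinner_mat_adjoint:
  assumes A: "A \<in> carrier_mat m m" and u: "u \<in> carrier_vec m" and w: "w \<in> carrier_vec m"
  shows "cinner m (($) (A *\<^sub>v u)) (($) w) = cinner m (($) u) (($) (mat_adjoint A *\<^sub>v w))"
proof -
  have "cinner m (($) (A *\<^sub>v u)) (($) w) = (\<Sum>i<m. \<Sum>j<m. u $ j * (A $$ (i, j) * cnj (w $ i)))"
    unfolding cinner_def
    by (intro sum.cong refl) (simp add: mult_mat_vec_index_sum[OF A u] sum_distrib_left mult_ac del: index_mult_mat_vec)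
  also have "\<dots> = (\<Sum>j<m. \<Sum>i<m. u $ j * (A $$ (i, j) * cnj (w $ i)))" by (rule sum.swap)
  also have "\<dots> = cinner m (($) u) (($) (mat_adjoint A *\<^sub>v w))"
    by (simp add: cinner_def mult_mat_vec_index_sum[OF mat_adjoint_carrier[OF A] w]
        mat_adjoint_index[OF A] sum_distrib_left)
  finally show ?thesis .
qed

lemma cinner_smult:
  assumes "u \<in> carrier_vec m" "w \<in> carrier_vec m"
  shows "cinner m (($) (c \<cdot>\<^sub>v u)) (($) w) = c * cinner m (($) u) (($) w)"
    and "cinner m (($) u) (($) (c \<cdot>\<^sub>v w)) = cnj c * cinner m (($) u) (($) w)"
  using assms by (simp_all add: cinner_def sum_distrib_left mult_ac)

lemma cinner_minus:
  assumes "u \<in> carrier_vec m" "u' \<in> carrier_vec m"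
  shows "cinner m (($) (u - u')) w = cinner m (($) u) w - cinner m (($) u') w"
  using assms by (simp add: cinner_def left_diff_distrib sum_subtractf)

context indexed_regular_classes
begin

lemma char_vec_eigen:
  assumes P: "irr_mat d P" and k: "k < m"
  shows "M k *\<^sub>v v (mat_char d P)
    = (of_nat (card (C k)) * mat_char d P (c\<^sub>0 k) / of_nat d) \<cdot>\<^sub>v v (mat_char d P)"
proof (rule eq_vecI)
  fix i assume "i < dim_vec ((of_nat (card (C k)) * mat_char d P (c\<^sub>0 k) / of_nat d) \<cdot>\<^sub>v v (mat_char d P))"
  then have i: "i < m" by simp
  show "(M k *\<^sub>v v (mat_char d P)) $ i
      = ((of_nat (card (C k)) * mat_char d P (c\<^sub>0 k) / of_nat d) \<cdot>\<^sub>v v (mat_char d P)) $ i"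
    using mult_mat_vec_index_sum[OF class_mat_carrier(1) char_vec_carrier(1) i, of k "mat_char d P"]
      class_mat_eigen[OF P k i] i by simp
qed simp

lemma char_vec_eigenvalue:
  assumes "\<chi> \<in> irr_chars G \<alpha>" "k < m"
  obtains l where "M k *\<^sub>v v \<chi> = l \<cdot>\<^sub>v v \<chi>"
  using assms irr_char_matrix_form char_vec_eigen by metis

lemma char_vec_nonzero:
  assumes "\<chi> \<in> irr_chars G \<alpha>" shows "v \<chi> \<noteq> 0\<^sub>v m"
  using char_vec_orthonormal[OF assms assms] by (auto simp: cinner_def)

lemma joint_eigenvector_char_vec:
  assumes \<chi>: "\<chi> \<in> irr_chars G \<alpha>"
  shows "joint_eigenvector m (M ` {..<m}) (v \<chi>)"
  unfolding joint_eigenvector_def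
proof (intro conjI ballI)
  fix A assume "A \<in> M ` {..<m}"
  then obtain k where k: "k < m" "A = M k" by auto
  obtain l where "M k *\<^sub>v v \<chi> = l \<cdot>\<^sub>v v \<chi>" using char_vec_eigenvalue[OF \<chi> k(1)] .
  then show "\<exists>l. eigenvector A (v \<chi>) l"
    using char_vec_nonzero[OF \<chi>] k by (auto simp: eigenvector_def)
qed (simp_all add: char_vec_nonzero[OF \<chi>])

lemma vec_zero_of_orthogonal:
  assumes u: "u \<in> carrier_vec m"
    and orth: "\<And>\<chi>. \<chi> \<in> irr_chars G \<alpha> \<Longrightarrow> cinner m (($) u) (($) (v \<chi>)) = 0"
  shows "u = 0\<^sub>v m"
  using char_vec_complete[OF orth] u by (intro eq_vecI) auto

text \<open>Both sides have the same inner products with the orthonormal basis of vectors $v_\psi$.\<close>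

lemma adjoint_eigen:
  assumes \<chi>: "\<chi> \<in> irr_chars G \<alpha>" and k: "k < m" and l: "M k *\<^sub>v v \<chi> = l \<cdot>\<^sub>v v \<chi>"
  shows "mat_adjoint (M k) *\<^sub>v v \<chi> = cnj l \<cdot>\<^sub>v v \<chi>"
proof -
  let ?A = "mat_adjoint (M k)"
  have A: "?A \<in> carrier_mat m m" by (rule mat_adjoint_carrier) simp
  have swap: "cinner m x y = cnj (cinner m y x)" for x y by (simp add: cinner_def mult.commute)
  have "?A *\<^sub>v v \<chi> - cnj l \<cdot>\<^sub>v v \<chi> = 0\<^sub>v m"
  proof (rule vec_zero_of_orthogonal)
    fix \<psi> assume \<psi>: "\<psi> \<in> irr_chars G \<alpha>"
    obtain l' where l': "M k *\<^sub>v v \<psi> = l' \<cdot>\<^sub>v v \<psi>" using char_vec_eigenvalue[OF \<psi> k] .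
    have "cinner m (($) (?A *\<^sub>v v \<chi>)) (($) (v \<psi>)) = cnj (cinner m (($) (M k *\<^sub>v v \<psi>)) (($) (v \<chi>)))"
      unfolding cinner_mat_adjoint[OF class_mat_carrier(1) char_vec_carrier(1) char_vec_carrier(1)]
      by (rule swap)
    also have "\<dots> = cnj (l' * cinner m (($) (v \<psi>)) (($) (v \<chi>)))"
      unfolding l' by (simp add: cinner_smult)
    also have "\<dots> = cnj l * cinner m (($) (v \<chi>)) (($) (v \<psi>))"
    proof (cases "\<chi> = \<psi>")
      case True
      have "l' \<cdot>\<^sub>v v \<chi> = l \<cdot>\<^sub>v v \<chi>" using l l' True by simp
      then have "cinner m (($) (l' \<cdot>\<^sub>v v \<chi>)) (($) (v \<chi>)) = cinner m (($) (l \<cdot>\<^sub>v v \<chi>)) (($) (v \<chi>))"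
        by simp
      then have "l' = l" using char_vec_orthonormal[OF \<chi> \<chi>] by (simp add: cinner_smult)
      then show ?thesis using True char_vec_orthonormal[OF \<chi> \<chi>] by simp
    qed (simp add: char_vec_orthonormal \<chi> \<psi>)
    finally show "cinner m (($) (?A *\<^sub>v v \<chi> - cnj l \<cdot>\<^sub>v v \<chi>)) (($) (v \<psi>)) = 0"
      using A by (simp add: cinner_minus cinner_smult)
  qed (use A in simp)
  moreover have "?A *\<^sub>v v \<chi> = (?A *\<^sub>v v \<chi> - cnj l \<cdot>\<^sub>v v \<chi>) + cnj l \<cdot>\<^sub>v v \<chi>"
    using A by (intro eq_vecI) auto
  ultimately show ?thesis using A by simp
qed

text \<open>Each row of the difference is, after conjugation, orthogonal to all $v_\chi$.\<close>

lemma mat_eq_of_char_vecs: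
  assumes A: "A \<in> carrier_mat m m" and B: "B \<in> carrier_mat m m"
    and eq: "\<And>\<chi>. \<chi> \<in> irr_chars G \<alpha> \<Longrightarrow> A *\<^sub>v v \<chi> = B *\<^sub>v v \<chi>"
  shows "A = B"
proof (rule eq_matI)
  fix i j assume "i < dim_row B" "j < dim_col B"
  then have ij: "i < m" "j < m" using B by auto
  define u where "u j = cnj (A $$ (i, j) - B $$ (i, j))" for j
  have "u j = 0"
  proof (rule char_vec_complete[OF _ ij(2)])
    fix \<chi> assume "\<chi> \<in> irr_chars G \<alpha>"
    then have "(A *\<^sub>v v \<chi>) $ i - (B *\<^sub>v v \<chi>) $ i = 0" using eq by simp
    then have "(\<Sum>j<m. (A $$ (i, j) - B $$ (i, j)) * v \<chi> $ j) = 0"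
      unfolding mult_mat_vec_index_sum[OF A char_vec_carrier(1) ij(1)]
        mult_mat_vec_index_sum[OF B char_vec_carrier(1) ij(1)]
      by (simp add: left_diff_distrib sum_subtractf)
    then have "cnj (\<Sum>j<m. (A $$ (i, j) - B $$ (i, j)) * v \<chi> $ j) = 0" by simp
    then show "cinner m u (($) (v \<chi>)) = 0" by (simp add: cinner_def u_def)
  qed
  then show "A $$ (i, j) = B $$ (i, j)" by (simp add: u_def)
qed (use A B in auto)

lemma mult_mat_vec_eigen:
  fixes A B :: "complex mat"
  assumes A: "A \<in> carrier_mat m m" and B: "B \<in> carrier_mat m m" and w: "w \<in> carrier_vec m"
    and a: "A *\<^sub>v w = a \<cdot>\<^sub>v w" and b: "B *\<^sub>v w = b \<cdot>\<^sub>v w"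
  shows "(A * B) *\<^sub>v w = (a * b) \<cdot>\<^sub>v w"
proof -
  have "(A * B) *\<^sub>v w = A *\<^sub>v (b \<cdot>\<^sub>v w)" using assoc_mult_mat_vec[OF A B w] b by simp
  also have "\<dots> = b \<cdot>\<^sub>v (A *\<^sub>v w)" using mult_mat_vec[OF A w] .
  also have "\<dots> = (a * b) \<cdot>\<^sub>v w" unfolding a by (simp add: smult_smult_assoc mult.commute)
  finally show ?thesis .
qed

lemma class_mats_commute:
  assumes k: "k < m" and l: "l < m" shows "M k * M l = M l * M k"
proof (rule mat_eq_of_char_vecs)
  fix \<chi> assume \<chi>: "\<chi> \<in> irr_chars G \<alpha>"
  obtain a b where "M k *\<^sub>v v \<chi> = a \<cdot>\<^sub>v v \<chi>" "M l *\<^sub>v v \<chi> = b \<cdot>\<^sub>v v \<chi>"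
    using char_vec_eigenvalue[OF \<chi> k] char_vec_eigenvalue[OF \<chi> l] by metis
  then show "M k * M l *\<^sub>v v \<chi> = M l * M k *\<^sub>v v \<chi>"
    using mult_mat_vec_eigen[of "M k" "M l" "v \<chi>" a b] mult_mat_vec_eigen[of "M l" "M k" "v \<chi>" b a]
    by (simp add: mult.commute)
qed (auto intro: mult_carrier_mat)

lemma class_mats_normal:
  assumes k: "k < m" shows "normal_mat (M k)"
  unfolding normal_mat_def
proof (rule mat_eq_of_char_vecs)
  have A: "mat_adjoint (M k) \<in> carrier_mat m m" by (rule mat_adjoint_carrier) simp
  show "M k * mat_adjoint (M k) \<in> carrier_mat m m" "mat_adjoint (M k) * M k \<in> carrier_mat m m"
    using A by (auto intro: mult_carrier_mat)
  fix \<chi> assume \<chi>: "\<chi> \<in> irr_chars G \<alpha>"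
  obtain a where a: "M k *\<^sub>v v \<chi> = a \<cdot>\<^sub>v v \<chi>" using char_vec_eigenvalue[OF \<chi> k] .
  show "M k * mat_adjoint (M k) *\<^sub>v v \<chi> = mat_adjoint (M k) * M k *\<^sub>v v \<chi>"
    using mult_mat_vec_eigen[OF class_mat_carrier(1) A char_vec_carrier(1) a adjoint_eigen[OF \<chi> k a]]
      mult_mat_vec_eigen[OF A class_mat_carrier(1) char_vec_carrier(1) adjoint_eigen[OF \<chi> k a] a]
    by (simp add: mult.commute)
qed

text \<open>If \<open>u\<close> has a component along $v_\psi$, pairing $M_A u$ with $v_\psi$ shows that \<open>u\<close> has the eigenvalues of
$v_\psi$. Two such characters have the same eigenvalues $|A|\chi(a_0)/d$, so their vectors are proportional and,
being orthonormal, equal. Hence only one component is present.\<close>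

lemma joint_eigenvector_is_char_vec:
  assumes u: "joint_eigenvector m (M ` {..<m}) u"
  obtains \<chi> c where "\<chi> \<in> irr_chars G \<alpha>" "c \<noteq> 0" "u = c \<cdot>\<^sub>v v \<chi>"
proof -
  have uc: "u \<in> carrier_vec m" and u0: "u \<noteq> 0\<^sub>v m" using u by (auto simp: joint_eigenvector_def)
  define co where "co \<chi> = cinner m (($) u) (($) (v \<chi>))" for \<chi>
  obtain \<chi> where \<chi>: "\<chi> \<in> irr_chars G \<alpha>" "co \<chi> \<noteq> 0"
    using vec_zero_of_orthogonal[OF uc] u0 unfolding co_def by blast
  \<comment> \<open>\<open>u\<close> shares the eigenvalues of every \<open>v \<psi>\<close> along which it has a component\<close>
  have eigenvalue: "M k *\<^sub>v u = l \<cdot>\<^sub>v u" 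
    if k: "k < m" and psi: "\<psi> \<in> irr_chars G \<alpha>" "co \<psi> \<noteq> 0" and l: "M k *\<^sub>v v \<psi> = l \<cdot>\<^sub>v v \<psi>" for k \<psi> l
  proof -
    obtain a where a: "M k *\<^sub>v u = a \<cdot>\<^sub>v u"
      using u k by (auto simp: joint_eigenvector_def eigenvector_def)
    have "a * co \<psi> = cinner m (($) (M k *\<^sub>v u)) (($) (v \<psi>))"
      unfolding a co_def using uc by (simp add: cinner_smult)
    also have "\<dots> = cinner m (($) u) (($) (cnj l \<cdot>\<^sub>v v \<psi>))"
      using cinner_mat_adjoint[OF class_mat_carrier(1) uc char_vec_carrier(1), of k \<psi>]
        adjoint_eigen[OF psi(1) k l] by simp
    also have "\<dots> = l * co \<psi>" using uc by (simp add: cinner_smult co_def)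
    finally show ?thesis using psi(2) a by simp
  qed
  have only: "\<psi> = \<chi>" if \<psi>: "\<psi> \<in> irr_chars G \<alpha>" "co \<psi> \<noteq> 0" for \<psi>
  proof (rule ccontr)
    assume ne: "\<psi> \<noteq> \<chi>"
    obtain d P where P: "irr_mat d P" "\<chi> = mat_char d P" using irr_char_matrix_form \<chi>(1) by blast
    obtain d' P' where P': "irr_mat d' P'" "\<psi> = mat_char d' P'" using irr_char_matrix_form \<psi>(1) by blast
    have d: "0 < d" "0 < d'" using P P' by (auto simp: irr_mat_def)
    obtain i0 where i0: "i0 < m" "u $ i0 \<noteq> 0" using uc u0 by (auto simp: vec_eq_iff)
    have "v \<chi> $ k = (of_nat d / of_nat d' \<cdot>\<^sub>v v \<psi>) $ k" if k: "k < m" for k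
    proof -
      have "(of_nat (card (C k)) * \<chi> (c\<^sub>0 k) / of_nat d) \<cdot>\<^sub>v u = (of_nat (card (C k)) * \<psi> (c\<^sub>0 k) / of_nat d') \<cdot>\<^sub>v u"
        using eigenvalue[OF k \<chi>] char_vec_eigen[OF P(1) k] eigenvalue[OF k \<psi>] char_vec_eigen[OF P'(1) k]
        unfolding P(2) P'(2) by metis
      then have "((of_nat (card (C k)) * \<chi> (c\<^sub>0 k) / of_nat d) \<cdot>\<^sub>v u) $ i0
          = ((of_nat (card (C k)) * \<psi> (c\<^sub>0 k) / of_nat d') \<cdot>\<^sub>v u) $ i0" by simp
      then have eq: "(of_nat (card (C k)) * u $ i0) * (\<chi> (c\<^sub>0 k) / of_nat d)
          = (of_nat (card (C k)) * u $ i0) * (\<psi> (c\<^sub>0 k) / of_nat d')"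
        using i0 uc by (simp add: mult_ac)
      have nz: "of_nat (card (C k)) * u $ i0 \<noteq> 0" using i0 card_class_pos[OF k] by simp
      have "\<chi> (c\<^sub>0 k) / of_nat d = \<psi> (c\<^sub>0 k) / of_nat d'"
        by (rule iffD1[OF mult_left_cancel[OF nz] eq])
      then have "\<chi> (c\<^sub>0 k) = of_nat d / of_nat d' * \<psi> (c\<^sub>0 k)" using d by (simp add: field_simps)
      then show ?thesis using k by (simp add: char_vec_index)
    qed
    then have eq: "v \<chi> = of_nat d / of_nat d' \<cdot>\<^sub>v v \<psi>" by (intro eq_vecI) auto
    have "cinner m (($) (v \<chi>)) (($) (v \<psi>)) = of_nat d / of_nat d'"
      unfolding eq using char_vec_orthonormal[OF \<psi>(1) \<psi>(1)] by (simp add: cinner_smult)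
    then show False using char_vec_orthonormal[OF \<chi>(1) \<psi>(1)] ne d by simp
  qed
  have "u - co \<chi> \<cdot>\<^sub>v v \<chi> = 0\<^sub>v m"
  proof (rule vec_zero_of_orthogonal)
    fix \<psi> assume \<psi>: "\<psi> \<in> irr_chars G \<alpha>"
    have "cinner m (($) (u - co \<chi> \<cdot>\<^sub>v v \<chi>)) (($) (v \<psi>))
        = co \<psi> - co \<chi> * cinner m (($) (v \<chi>)) (($) (v \<psi>))"
      using uc by (simp add: cinner_minus cinner_smult co_def)
    then show "cinner m (($) (u - co \<chi> \<cdot>\<^sub>v v \<chi>)) (($) (v \<psi>)) = 0"
      using char_vec_orthonormal[OF \<chi>(1) \<psi>] only[OF \<psi>] by (cases "co \<psi> = 0") auto
  qed (use uc in simp)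
  moreover have "u = (u - co \<chi> \<cdot>\<^sub>v v \<chi>) + co \<chi> \<cdot>\<^sub>v v \<chi>" using uc by (intro eq_vecI) auto
  ultimately have "u = co \<chi> \<cdot>\<^sub>v v \<chi>" by simp
  with \<chi> that show thesis by blast
qed

lemma char_vec_lines_bij:
  "bij_betw (\<lambda>\<chi>. scalar_class (v \<chi>)) (irr_chars G \<alpha>) (joint_eigenlines m (M ` {..<m}))"
  unfolding bij_betw_def
proof
  show "inj_on (\<lambda>\<chi>. scalar_class (v \<chi>)) (irr_chars G \<alpha>)"
  proof (rule inj_onI)
    fix \<chi> \<psi> assume \<chi>: "\<chi> \<in> irr_chars G \<alpha>" and \<psi>: "\<psi> \<in> irr_chars G \<alpha>"
      and eq: "scalar_class (v \<chi>) = scalar_class (v \<psi>)"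
    have "1 \<cdot>\<^sub>v v \<chi> \<in> scalar_class (v \<chi>)" unfolding scalar_class_def by (intro CollectI exI[of _ 1]) simp
    then obtain c where c: "c \<noteq> 0" "v \<chi> = c \<cdot>\<^sub>v v \<psi>" unfolding eq by (auto simp: scalar_class_def)
    have "cinner m (($) (v \<chi>)) (($) (v \<psi>)) = c"
      unfolding c(2) using char_vec_orthonormal[OF \<psi> \<psi>] by (simp add: cinner_smult)
    then show "\<chi> = \<psi>" using char_vec_orthonormal[OF \<chi> \<psi>] c(1) by (auto split: if_splits)
  qed
  have scaled: "scalar_class (c \<cdot>\<^sub>v w) = scalar_class w" if "c \<noteq> 0" for c w
  proof -
    have "\<exists>b. a \<cdot>\<^sub>v w = b \<cdot>\<^sub>v (c \<cdot>\<^sub>v w) \<and> b \<noteq> 0" if "a \<noteq> 0" for a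
      using that \<open>c \<noteq> 0\<close> by (intro exI[of _ "a / c"]) (simp add: smult_smult_assoc)
    moreover have "\<exists>b. a \<cdot>\<^sub>v (c \<cdot>\<^sub>v w) = b \<cdot>\<^sub>v w \<and> b \<noteq> 0" if "a \<noteq> 0" for a
      using that \<open>c \<noteq> 0\<close> by (intro exI[of _ "a * c"]) (simp add: smult_smult_assoc)
    ultimately show ?thesis unfolding scalar_class_def by auto
  qed
  show "(\<lambda>\<chi>. scalar_class (v \<chi>)) ` irr_chars G \<alpha> = joint_eigenlines m (M ` {..<m})"
  proof
    show "(\<lambda>\<chi>. scalar_class (v \<chi>)) ` irr_chars G \<alpha> \<subseteq> joint_eigenlines m (M ` {..<m})"
      using joint_eigenvector_char_vec by (auto simp: joint_eigenlines_def)
    show "joint_eigenlines m (M ` {..<m}) \<subseteq> (\<lambda>\<chi>. scalar_class (v \<chi>)) ` irr_chars G \<alpha>"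
    proof
      fix K assume "K \<in> joint_eigenlines m (M ` {..<m})"
      then obtain u where u: "joint_eigenvector m (M ` {..<m}) u" "K = scalar_class u"
        by (auto simp: joint_eigenlines_def)
      obtain \<chi> c where "\<chi> \<in> irr_chars G \<alpha>" "c \<noteq> 0" "u = c \<cdot>\<^sub>v v \<chi>"
        using joint_eigenvector_is_char_vec[OF u(1)] .
      then show "K \<in> (\<lambda>\<chi>. scalar_class (v \<chi>)) ` irr_chars G \<alpha>" using u(2) scaled by auto
    qed
  qed
qed

lemma irr_chars_card: "finite (irr_chars G \<alpha>)" "card (irr_chars G \<alpha>) = m"
  using orthonormal_basis_card[of "irr_chars G \<alpha>" m "\<lambda>\<chi>. ($) (v \<chi>)"]
    char_vec_orthonormal char_vec_complete by blast+

lemma irreducible_rep_char_eigen: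
  assumes irr: "irreducible_proj_rep G \<alpha> s V \<pi>"
  shows "rep_char G s V \<pi> \<in> irr_chars G \<alpha>"
    and "k < m \<Longrightarrow> M k *\<^sub>v v (rep_char G s V \<pi>) =
      (of_nat (card (C k)) * rep_char G s V \<pi> (c\<^sub>0 k) / of_nat (vector_space.dim s V)) \<cdot>\<^sub>v v (rep_char G s V \<pi>)"
proof -
  let ?d = "vector_space.dim s V"
  have "\<exists>P. irr_mat ?d P \<and> rep_char G s V \<pi> = mat_char ?d P"
    by (rule irreducible_proj_rep_matrix_form[OF irr]) blast
  then obtain P where P: "irr_mat ?d P" "rep_char G s V \<pi> = mat_char ?d P" by blast
  show "rep_char G s V \<pi> \<in> irr_chars G \<alpha>" unfolding P(2) by (rule mat_char_in_irr_chars[OF P(1)])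
  show "M k *\<^sub>v v (rep_char G s V \<pi>) =
      (of_nat (card (C k)) * rep_char G s V \<pi> (c\<^sub>0 k) / of_nat ?d) \<cdot>\<^sub>v v (rep_char G s V \<pi>)" if "k < m"
    unfolding P(2) by (rule char_vec_eigen[OF P(1) that])
qed

end

theorem theorem1:
  fixes G :: "('a, 'b) monoid_scheme"
    and \<alpha> :: "'a \<Rightarrow> 'a \<Rightarrow> complex"
    and m :: nat
    and C :: "nat \<Rightarrow> 'a set"
    and c\<^sub>0 :: "nat \<Rightarrow> 'a"
    and s :: "complex \<Rightarrow> 'v::ab_group_add \<Rightarrow> 'v"
  defines "M \<equiv> class_mat G \<alpha> m C c\<^sub>0"
    and "v \<equiv> char_vec G m C c\<^sub>0"
  assumes "group G" and "finite (carrier G)"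
    and "unitary_multiplier G \<alpha>"
    and "bij_betw C {..<m} (regular_classes G \<alpha>)"
    and "\<And>i. i < m \<Longrightarrow> c\<^sub>0 i \<in> C i"
  shows
    "(\<forall>V \<pi>. irreducible_proj_rep G \<alpha> s V \<pi> \<longrightarrow>
        (let \<chi> = rep_char G s V \<pi>; d = vector_space.dim s V in
           (\<forall>k<m. M k *\<^sub>v v \<chi> = (of_nat (card (C k)) * \<chi> (c\<^sub>0 k) / of_nat d) \<cdot>\<^sub>v v \<chi>) \<and>
           joint_eigenvector m (M ` {..<m}) (v \<chi>) \<and>
           \<chi> \<in> irr_chars G \<alpha>)) \<and>
     (\<forall>k<m. normal_mat (M k)) \<and>
     (\<forall>k<m. \<forall>l<m. M k * M l = M l * M k) \<and>
     finite (joint_eigenlines m (M ` {..<m})) \<and>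
     card (joint_eigenlines m (M ` {..<m})) = m \<and>
     bij_betw (\<lambda>\<chi>. scalar_class (v \<chi>)) (irr_chars G \<alpha>) (joint_eigenlines m (M ` {..<m}))"
proof -
  interpret indexed_regular_classes G \<alpha> m C c\<^sub>0
    using assms by (intro indexed_regular_classes.intro unitary_twist.intro
      unitary_twist_axioms.intro indexed_regular_classes_axioms.intro)
  have "finite (joint_eigenlines m (M ` {..<m}))" "card (joint_eigenlines m (M ` {..<m})) = m"
    using irr_chars_card bij_betw_finite[OF char_vec_lines_bij] bij_betw_same_card[OF char_vec_lines_bij]
    by (simp_all add: M_def)
  then show ?thesis
    unfolding M_def v_def Let_def
    using irreducible_rep_char_eigen joint_eigenvector_char_vec class_mats_normal class_mats_commute
      char_vec_lines_bij
    by (intro conjI allI impI) auto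
qed

end
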